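(* Consider a $K$-user computation broadcast model with $N$ datasets $X_{[N]}=(X_1,\dots,X_N)$ with values in $\mathbb{F}_q^N$ and joint PMF $P_{X_{[N]}}$, side information $\mathcal{S}_i\subseteq X_{[N]}$ and demanded function $f_i=f_i(X_1,\dots,X_N)$ at user $i\in[K]$, and broadcast graph $G_{\cup_{i=1}^{K}f_i}$. Let $\Gamma(G_{\cup_{i=1}^{K}f_i})$ be the set of maximal independent sets of $G_{\cup_{i=1}^{K}f_i}$. Define $$R_{ach}=\min_{X_{[N]}\in W\in \Gamma(G_{\cup_{i'=1}^{K}f_{i'}})}\ \max_{i\in [K]} I(X_{[N]};W\mid \mathcal{S}_{i}),$$ where the minimum is over all joint PMFs $P_{W,X_{[N]}}$ with $X_{[N]}$-marginal $P_{X_{[N]}}$, with $W$ taking values in $\Gamma(G_{\cup_{i=1}^{K}f_i})$, and such that $P_{W,X_{[N]}}(w,x_{[N]})>0$ implies $x_{[N]}\in w$; and define $$R_{con}=\min_{p(u\mid x_{[N]})}\ \max_{i\in [K]} I(X_{[N]};U\mid \mathcal{S}_{i}),$$ where the minimum is over all conditional PMFs $p(u\mid x_{[N]})$ of an auxiliary random variable $U$ given $X_{[N]}$. Then $R_{ach}$ is an upper bound and $R_{con}$ is a lower bound on the optimal communication rate $R^*$ of the broadcast message $M$, i.e. $$R_{con}\ \le\ R^{*}\ \le\ R_{ach}.$$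
   Context: Notation: $[N]=\{1,\dots,N\}$; $q\ge 2$ is the order of the finite field $\mathbb{F}_q$; entropies $H_q$ and mutual informations $I$ are taken with logarithms to base $q$; PMF means probability mass function. Model. A master node holds $N$ datasets $X_{[N]}=(X_1,\dots,X_N)$, $X_j\in\mathbb{F}_q$, with an arbitrary joint PMF $P_{X_{[N]}}$. There are $K$ users. User $i\in[K]$ has as side information a sub-collection $\mathcal{S}_i\subseteq X_{[N]}$ of the datasets (i.e. $\mathcal{S}_i=(X_j)_{j\in A_i}$ for a fixed index set $A_i\subseteq[N]$) and wants to compute a function $f_i=f_i(X_1,\dots,X_N)$, where $f_i:\mathbb{F}_q^N\to\mathbb{F}_q$ is arbitrary (linear or non-linear). The sources are observed over $n$ i.i.d. realizations: $X_{[N]}^n=(X_{[N],t})_{t\in[n]}$ is i.i.d. according to $P_{X_{[N]}}$, $\mathcal{S}_i^n=(\mathcal{S}_{i,t})_{t\in[n]}$, and $f_i^n=(f_i(X_{1,t},\dots,X_{N,t}))_{t\in[n]}$. The master broadcasts a single message $M=\psi(X_1^n,\dots,X_N^n)$ to all users, and user $i$ forms an estimate $\hat f_i^n$ as a function of $(M,\mathcal{S}_i^n)$. Communication rate. The rate of the message is measured by $H_q(M)$ per source realization. A rate $R$ is achievable if for every $\epsilon>0$ and all sufficiently large $n$ there are an encoder $\psi$ with $H_q(M)\le n(R+\epsilon)$ and decoders for the users such that $P(\hat f_i^n\ne f_i^n)<\epsilon$ for all $i\in[K]$ (asymptotically lossless recovery). The optimal rate $R^*$ is the infimum of all achievable rates.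 Characteristic graph and broadcast graph. For user $i$, the characteristic graph $G_{f_i}=G(\mathcal{V},\mathcal{E}_i)$ has vertex set $\mathcal{V}=\mathbb{F}_q^N$ (the values of $X_{[N]}$), and two distinct vertices $x,x'\in\mathcal{V}$ are joined by an edge in $\mathcal{E}_i$ if and only if there is a value $y$ of $\mathcal{S}_i$ such that $P_{X_{[N]},\mathcal{S}_i}(x,y)\cdot P_{X_{[N]},\mathcal{S}_i}(x',y)>0$ and $f_i(x)\neq f_i(x')$. The broadcast graph is the union graph $G_{\cup_{i=1}^{K}f_i}=G(\mathcal{V},\bigcup_{i=1}^K\mathcal{E}_i)$. An independent set is a set of vertices no two of which are joined by an edge; a maximal independent set is an independent set not properly contained in another independent set. *)

theory Defs
  imports "HOL-Probability.Probability" "HOL-Library.Ramsey"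
begin

text \<open>
  A vector of datasets is an element of \<^typ>\<open>'a ^ 'n\<close>, where \<open>'a\<close> is a finite field with
  \<open>q = CARD('a)\<close> elements and \<open>N = CARD('n)\<close>. Users are the elements of a finite type \<open>'k\<close>,
  with \<open>K = CARD('k)\<close>. User \<open>i\<close> observes the datasets with index in \<open>A i\<close> and demands \<open>f i\<close>.
\<close>

definition side_info :: "'n set \<Rightarrow> 'a ^ 'n \<Rightarrow> 'n \<Rightarrow> 'a" where
  "side_info A x = restrict (\<lambda>j. x $ j) A"

definition user_edges ::
  "('a::{finite,field} ^ 'n::finite) pmf \<Rightarrow> 'n set \<Rightarrow> ('a ^ 'n \<Rightarrow> 'a) \<Rightarrow> ('a ^ 'n) set set" where
  "user_edges P A f =
     (let PXS = map_pmf (\<lambda>x. (x, side_info A x)) P in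
      {{x, x'} | x x'. x \<noteq> x' \<and> (\<exists>y. pmf PXS (x, y) * pmf PXS (x', y) > 0 \<and> f x \<noteq> f x')})"

definition broadcast_edges ::
  "('a::{finite,field} ^ 'n::finite) pmf \<Rightarrow> ('k::finite \<Rightarrow> 'n set) \<Rightarrow> ('k \<Rightarrow> 'a ^ 'n \<Rightarrow> 'a) \<Rightarrow>
    ('a ^ 'n) set set" where
  "broadcast_edges P A f = (\<Union>i. user_edges P (A i) (f i))"

text \<open>The maximal independent sets of the graph with vertex set \<^term>\<open>UNIV\<close> and edge set \<open>E\<close>;
  \<^const>\<open>indep\<close> is graph-theoretic independence from \<^theory>\<open>HOL-Library.Ramsey\<close>.\<close>

definition max_indep_sets :: "'v set set \<Rightarrow> 'v set set" where
  "max_indep_sets E = {w. indep w E \<and> \<not> (\<exists>w'. indep w' E \<and> w \<subset> w')}"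

text \<open>\<open>I(X; W | S)\<close> with logarithms to base \<open>q\<close>, for \<open>(W, X)\<close> distributed according to \<open>Q\<close> and
  \<open>S\<close> the sub-collection of \<open>X\<close> with index set \<open>A\<close>.\<close>

definition info_given_side :: "('w \<times> ('a::{finite,field} ^ 'n::finite)) pmf \<Rightarrow> 'n set \<Rightarrow> real" where
  "info_given_side Q A =
     prob_space.conditional_mutual_information (measure_pmf Q) (real CARD('a))
       (count_space UNIV) (count_space UNIV) (count_space UNIV)
       snd fst (\<lambda>z. side_info A (snd z))"

definition set_couplings ::
  "('a::{finite,field} ^ 'n::finite) pmf \<Rightarrow> ('k::finite \<Rightarrow> 'n set) \<Rightarrow> ('k \<Rightarrow> 'a ^ 'n \<Rightarrow> 'a) \<Rightarrow>
    (('a ^ 'n) set \<times> ('a ^ 'n)) pmf set" where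
  "set_couplings P A f =
     {Q. map_pmf snd Q = P \<and>
         (\<forall>w x. pmf Q (w, x) > 0 \<longrightarrow> w \<in> max_indep_sets (broadcast_edges P A f) \<and> x \<in> w)}"

definition R_ach ::
  "('a::{finite,field} ^ 'n::finite) pmf \<Rightarrow> ('k::finite \<Rightarrow> 'n set) \<Rightarrow> ('k \<Rightarrow> 'a ^ 'n \<Rightarrow> 'a) \<Rightarrow> real" where
  "R_ach P A f = (INF Q\<in>set_couplings P A f. MAX i. info_given_side Q (A i))"

text \<open>A PMF has countable support, so the values of the auxiliary variable \<open>U\<close> can be taken to be
  natural numbers.\<close>

definition aux_joint :: "'x pmf \<Rightarrow> ('x \<Rightarrow> nat pmf) \<Rightarrow> (nat \<times> 'x) pmf" where
  "aux_joint P \<kappa> = do {x \<leftarrow> P; u \<leftarrow> \<kappa> x; return_pmf (u, x)}"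

definition R_con ::
  "('a::{finite,field} ^ 'n::finite) pmf \<Rightarrow> ('k::finite \<Rightarrow> 'n set) \<Rightarrow> real" where
  "R_con P A = (INF \<kappa>\<in>UNIV. MAX i. info_given_side (aux_joint P \<kappa>) (A i))"

text \<open>An encoder is applied to a block of \<open>n\<close> i.i.d. source vectors. There are only finitely many
  such blocks, so messages can be taken to be natural numbers.\<close>

definition achievable_rate ::
  "('a::{finite,field} ^ 'n::finite) pmf \<Rightarrow> ('k::finite \<Rightarrow> 'n set) \<Rightarrow> ('k \<Rightarrow> 'a ^ 'n \<Rightarrow> 'a) \<Rightarrow>
    real \<Rightarrow> bool" where
  "achievable_rate P A f R \<longleftrightarrow>
     (\<forall>\<epsilon>>0. \<forall>\<^sub>F n in sequentially.
        \<exists>(\<psi> :: ('a ^ 'n) list \<Rightarrow> nat) (dec :: 'k \<Rightarrow> nat \<Rightarrow> ('n \<Rightarrow> 'a) list \<Rightarrow> 'a list).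
          prob_space.entropy (measure_pmf (replicate_pmf n P)) (real CARD('a)) (count_space UNIV) \<psi>
            \<le> real n * (R + \<epsilon>) \<and>
          (\<forall>i. measure_pmf.prob (replicate_pmf n P)
                 {xs. dec i (\<psi> xs) (map (side_info (A i)) xs) \<noteq> map (f i) xs} < \<epsilon>))"

definition R_opt ::
  "('a::{finite,field} ^ 'n::finite) pmf \<Rightarrow> ('k::finite \<Rightarrow> 'n set) \<Rightarrow> ('k \<Rightarrow> 'a ^ 'n \<Rightarrow> 'a) \<Rightarrow> real" where
  "R_opt P A f = Inf {R. achievable_rate P A f R}"

end

theory Submission
  imports Defs
begin

text \<open>
  The auxiliary variable in \<^const>\<open>R_con\<close> is unconstrained, so a constant one shows that
  \<^const>\<open>R_con\<close> is at most \<open>0\<close>, while achievable rates are nonnegative because entropies are.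

  For the upper bound fix an admissible coupling of \<open>W\<close> and \<open>X\<close> and write \<open>I(X; W | S) = I(X; W) - I(S; W)\<close>,
  which holds because \<open>S\<close> is a function of \<open>X\<close>. Draw about \<open>q\<close> to the power \<open>n I(X; W)\<close> codewords
  from the law of \<open>W\<close> and hash them into about \<open>q\<close> to the power \<open>n R\<close> bins. The encoder sends the bin of a
  codeword jointly typical with the source block, and user \<open>i\<close> looks in that bin for the codeword that is
  jointly typical with its side information; a wrong one survives with probability about
  \<open>q\<close> to the power \<open>- n I(S; W)\<close>. Here typicality only means that the information densities are close to
  their means. An independent set and the side information together determine the demanded value.
\<close>

subsection \<open>Information quantities as expectations\<close>

lemma distributed_pmf:
  "distributed (measure_pmf Q) (count_space UNIV) X (\<lambda>x. ennreal (pmf (map_pmf X Q) x))"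
  unfolding distributed_def
  by (simp add: map_pmf_rep_eq[symmetric] measure_pmf_eq_density[symmetric])

lemma information_space_pmf:
  "b > 1 \<Longrightarrow> information_space (measure_pmf Q) b"
  by (simp add: information_space_def information_space_axioms_def measure_pmf.prob_space_axioms)

text \<open>Countability makes the product of counting measures a counting measure again, so mutual
  information is the mean information density. Infinite supports are covered, as the auxiliary
  variable of \<open>R_con\<close> may have one.\<close>

lemma mutual_information_pmf:
  fixes X :: "'z \<Rightarrow> 'x::countable" and Y :: "'z \<Rightarrow> 'y::countable"
  assumes "b > 1"
  shows "prob_space.mutual_information (measure_pmf Q) b (count_space UNIV) (count_space UNIV) X Y
       = measure_pmf.expectation Q (\<lambda>z. log b (pmf (map_pmf (\<lambda>z. (X z, Y z)) Q) (X z, Y z)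
           / (pmf (map_pmf X Q) (X z) * pmf (map_pmf Y Q) (Y z))))" (is "?I = ?E")
    and "0 \<le> prob_space.mutual_information (measure_pmf Q) b (count_space UNIV) (count_space UNIV) X Y"
proof -
  interpret information_space "measure_pmf Q" b
    using assms by (rule information_space_pmf)
  have pm: "count_space UNIV \<Otimes>\<^sub>M count_space UNIV = (count_space UNIV :: ('x \<times> 'y) measure)"
    by (simp add: pair_measure_countable)
  define r where "r = (\<lambda>v. log b (pmf (map_pmf (\<lambda>z. (X z, Y z)) Q) v
      / (pmf (map_pmf X Q) (fst v) * pmf (map_pmf Y Q) (snd v))))"
  have sf: "sigma_finite_measure (count_space (UNIV :: 'x set))"
    "sigma_finite_measure (count_space (UNIV :: 'y set))"
    by (auto intro!: sigma_finite_measure_count_space_countable)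
  have d: "distributed (measure_pmf Q) (count_space UNIV \<Otimes>\<^sub>M count_space UNIV) (\<lambda>z. (X z, Y z))
     (\<lambda>v. ennreal (pmf (map_pmf (\<lambda>z. (X z, Y z)) Q) v))"
    unfolding pm by (rule distributed_pmf)
  have *: "?I = (\<integral>v. pmf (map_pmf (\<lambda>z. (X z, Y z)) Q) v * r v \<partial>count_space UNIV)"
    using mutual_information_distr[OF sf distributed_pmf _ distributed_pmf _ d]
    by (simp add: r_def pm)
  also have "\<dots> = measure_pmf.expectation (map_pmf (\<lambda>z. (X z, Y z)) Q) r"
    unfolding measure_pmf_eq_density[of "map_pmf (\<lambda>z. (X z, Y z)) Q"]
    by (subst integral_density) auto
  finally show E: "?I = ?E" by (simp add: r_def)
  show "0 \<le> ?I"
  proof (cases "integrable (count_space UNIV) (\<lambda>v. pmf (map_pmf (\<lambda>z. (X z, Y z)) Q) v * r v)")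
    case True
    then show ?thesis
      using mutual_information_nonneg[OF sf distributed_pmf _ distributed_pmf _ d]
      by (simp add: r_def pm)
  next
    \<comment> \<open>The Bochner integral of a non-integrable function is \<open>0\<close>, so the
      bound holds by this convention.\<close>
    case False
    then show ?thesis unfolding * by (simp add: not_integrable_integral_eq)
  qed
qed

lemma entropy_pmf_nonneg:
  assumes "b > 1"
  shows "0 \<le> prob_space.entropy (measure_pmf Q) b (count_space UNIV) X"
proof -
  interpret information_space "measure_pmf Q" b
    using assms by (rule information_space_pmf)
  have "(\<integral>x. - (pmf (map_pmf X Q) x * log b (pmf (map_pmf X Q) x)) \<partial>count_space UNIV) \<ge> 0"
  proof (intro Bochner_Integration.integral_nonneg)
    fix x
    show "0 \<le> - (pmf (map_pmf X Q) x * log b (pmf (map_pmf X Q) x))"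
    proof (cases "pmf (map_pmf X Q) x = 0")
      case False
      then have "log b (pmf (map_pmf X Q) x) \<le> 0"
        using assms by (simp add: pmf_le_1)
      then show ?thesis by (simp add: mult_nonneg_nonpos)
    qed simp
  qed
  then show ?thesis
    by (simp add: entropy_distr[OF distributed_pmf])
qed

text \<open>The uniform law on the support maximises entropy. This turns a bin count
  \<open>B\<close> into a bound on the message rate.\<close>

lemma entropy_pmf_le_log_bound:
  fixes X :: "'z \<Rightarrow> nat"
  assumes "b > 1" and "\<And>z. X z < B"
  shows "prob_space.entropy (measure_pmf Q) b (count_space UNIV) X \<le> log b (real B)"
proof -
  interpret information_space "measure_pmf Q" b
    using assms(1) by (rule information_space_pmf)
  let ?N = "{x. pmf (map_pmf X Q) x \<noteq> 0}"
  have sub: "?N \<subseteq> {..<B}"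
    using assms(2) by (auto simp: pmf_eq_0_set_pmf)
  then have fin: "finite ?N" by (rule finite_subset) simp
  have ne: "?N \<noteq> {}"
    using set_pmf_not_empty[of "map_pmf X Q"] unfolding set_pmf_eq by blast
  have "prob_space.entropy (measure_pmf Q) b (count_space UNIV) X \<le> log b (measure (count_space UNIV) ?N)"
    using entropy_le[OF distributed_pmf[of Q X]] fin summable_finite[OF fin, of "\<lambda>x. \<bar>pmf (map_pmf X Q) x * log b (pmf (map_pmf X Q) x)\<bar>"]
    by (simp add: integrable_count_space_nat_iff)
  also have "measure (count_space UNIV) ?N = real (card ?N)"
    using fin by (simp add: measure_count_space)
  also have "log b (real (card ?N)) \<le> log b (real B)"
    using assms(1) fin ne card_mono[OF _ sub] by (auto simp: card_gt_0_iff intro!: log_mono)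
  finally show ?thesis .
qed

text \<open>By definition this is I(X; (W, S)) - I(X; S). As S is a function of X, both densities
  simplify, and on the support their difference is \<open>a z - c z\<close>. Nonnegativity is Gibbs'
  inequality for \<open>Q\<close> against the law that makes X and W conditionally independent given
  S.\<close>

lemma conditional_mutual_information_pmf:
  fixes Q :: "('w::countable \<times> 'x::countable) pmf" and s :: "'x \<Rightarrow> 's::countable"
  assumes fin: "finite (set_pmf Q)" and b: "b > 1"
  defines "a \<equiv> \<lambda>z. log b (pmf Q z / (pmf (map_pmf fst Q) (fst z) * pmf (map_pmf snd Q) (snd z)))"
    and "c \<equiv> \<lambda>z. log b (pmf (map_pmf (\<lambda>(w, x). (w, s x)) Q) (fst z, s (snd z))
        / (pmf (map_pmf fst Q) (fst z) * pmf (map_pmf (\<lambda>z. s (snd z)) Q) (s (snd z))))"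
  shows "prob_space.conditional_mutual_information (measure_pmf Q) b
      (count_space UNIV) (count_space UNIV) (count_space UNIV) snd fst (\<lambda>z. s (snd z))
    = measure_pmf.expectation Q a - measure_pmf.expectation Q c" (is "?I = _")
    and "0 \<le> prob_space.conditional_mutual_information (measure_pmf Q) b
      (count_space UNIV) (count_space UNIV) (count_space UNIV) snd fst (\<lambda>z. s (snd z))"
proof -
  define P W where "P = map_pmf snd Q" and "W = map_pmf fst Q"
  define WS PS where "WS = map_pmf (\<lambda>(w, x). (w, s x)) Q"
    and "PS = map_pmf (\<lambda>z. s (snd z)) Q"
  have pm: "count_space UNIV \<Otimes>\<^sub>M count_space UNIV = (count_space UNIV :: ('w \<times> 's) measure)"
    by (simp add: pair_measure_countable)
  have int: "integrable (measure_pmf Q) h" for h :: "_ \<Rightarrow> real"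
    using fin by (rule integrable_measure_pmf_finite)
  have pos: "pmf Q z > 0" "pmf W (fst z) > 0" "pmf P (snd z) > 0"
      "pmf WS (fst z, s (snd z)) > 0" "pmf PS (s (snd z)) > 0" if "z \<in> set_pmf Q" for z
    using that by (auto simp: W_def P_def WS_def PS_def pmf_positive_iff intro: rev_image_eqI)
  \<comment> \<open>Appending a function of a component already present is injective, so it keeps
    point masses.\<close>
  have XWS: "pmf (map_pmf (\<lambda>z. (snd z, fst z, s (snd z))) Q) (snd z, fst z, s (snd z)) = pmf Q z" for z
    using pmf_map_inj'[of "\<lambda>z. (snd z, fst z, s (snd z))" Q z] by (auto simp: inj_def)
  have XS: "pmf (map_pmf (\<lambda>z. (snd z, s (snd z))) Q) (snd z, s (snd z)) = pmf P (snd z)" for z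
    using pmf_map_inj'[of "\<lambda>x. (x, s x)" P "snd z"] by (auto simp: inj_def P_def map_pmf_comp)
  \<comment> \<open>The mass at \<open>z\<close> under conditional independence of W and X given S,
    divided by the mass under \<open>Q\<close>.\<close>
  define r where "r = (\<lambda>z. pmf P (snd z) * pmf WS (fst z, s (snd z)) / (pmf Q z * pmf PS (s (snd z))))"
  have "prob_space.mutual_information (measure_pmf Q) b (count_space UNIV) (count_space UNIV)
      snd (\<lambda>z. (fst z, s (snd z)))
    = measure_pmf.expectation Q (\<lambda>z. log b (pmf Q z / (pmf P (snd z) * pmf WS (fst z, s (snd z)))))"
    using mutual_information_pmf(1)[OF b, of Q snd "\<lambda>z. (fst z, s (snd z))"]
    by (simp only: XWS WS_def P_def split_beta')
  moreover have "prob_space.mutual_information (measure_pmf Q) b (count_space UNIV) (count_space UNIV)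
      snd (\<lambda>z. s (snd z))
    = measure_pmf.expectation Q (\<lambda>z. log b (pmf P (snd z) / (pmf P (snd z) * pmf PS (s (snd z)))))"
    using mutual_information_pmf(1)[OF b, of Q snd "\<lambda>z. s (snd z)"]
    by (simp only: XS P_def PS_def)
  ultimately have "?I = measure_pmf.expectation Q (\<lambda>z. log b (pmf Q z / (pmf P (snd z) * pmf WS (fst z, s (snd z)))))
     - measure_pmf.expectation Q (\<lambda>z. log b (pmf P (snd z) / (pmf P (snd z) * pmf PS (s (snd z)))))"
    by (simp only: prob_space.conditional_mutual_information_def[OF measure_pmf.prob_space_axioms] pm)
  also have "\<dots> = measure_pmf.expectation Q (\<lambda>z.
      log b (pmf Q z / (pmf P (snd z) * pmf WS (fst z, s (snd z)))) -
      log b (pmf P (snd z) / (pmf P (snd z) * pmf PS (s (snd z)))))"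
    using int by simp
  finally have I: "?I = \<dots>" .
  also have "\<dots> = measure_pmf.expectation Q (\<lambda>z. a z - c z)"
  proof (rule integral_cong_AE)
    show "AE z in measure_pmf Q. log b (pmf Q z / (pmf P (snd z) * pmf WS (fst z, s (snd z)))) -
      log b (pmf P (snd z) / (pmf P (snd z) * pmf PS (s (snd z)))) = a z - c z"
    proof (rule AE_pmfI)
      fix z assume "z \<in> set_pmf Q"
      from pos[OF this] show "log b (pmf Q z / (pmf P (snd z) * pmf WS (fst z, s (snd z)))) -
          log b (pmf P (snd z) / (pmf P (snd z) * pmf PS (s (snd z)))) = a z - c z"
        unfolding a_def c_def W_def[symmetric] P_def[symmetric] WS_def[symmetric] PS_def[symmetric]
        using b by (simp add: log_mult_pos log_divide_pos)
    qed
  qed simp_all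
  finally show "?I = measure_pmf.expectation Q a - measure_pmf.expectation Q c"
    using int by simp

  have "measure_pmf.expectation Q r = (\<Sum>z\<in>set_pmf Q. r z * pmf Q z)"
    using fin by (simp add: integral_measure_pmf_real)
  also have "\<dots> = (\<Sum>z\<in>set_pmf Q. pmf P (snd z) / pmf PS (s (snd z)) * pmf WS (fst z, s (snd z)))"
  proof (rule sum.cong[OF refl])
    fix z assume "z \<in> set_pmf Q"
    from pos(1)[OF this]
    show "r z * pmf Q z = pmf P (snd z) / pmf PS (s (snd z)) * pmf WS (fst z, s (snd z))"
      by (simp add: r_def)
  qed
  \<comment> \<open>Passing to the product of the marginal supports adds only nonnegative terms and
    lets \<open>w\<close> be summed out for fixed \<open>x\<close>.\<close>
  also have "\<dots> \<le> (\<Sum>(w, x)\<in>set_pmf W \<times> set_pmf P. pmf P x / pmf PS (s x) * pmf WS (w, s x))"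
    unfolding split_beta'
    by (rule sum_mono2) (use fin in \<open>force simp: W_def P_def\<close>)+
  also have "\<dots> = (\<Sum>x\<in>set_pmf P. pmf P x / pmf PS (s x) * (\<Sum>w\<in>set_pmf W. pmf WS (w, s x)))"
    by (subst sum.cartesian_product[symmetric], subst sum.swap) (simp add: sum_distrib_left)
  also have "\<dots> \<le> (\<Sum>x\<in>set_pmf P. pmf P x)"
  proof (rule sum_mono)
    fix x assume "x \<in> set_pmf P"
    then have psx: "pmf PS (s x) > 0" by (auto simp: P_def PS_def pmf_positive_iff)
    have "(\<Sum>w\<in>set_pmf W. pmf WS (w, s x)) = measure_pmf.prob WS ((\<lambda>w. (w, s x)) ` set_pmf W)"
      using fin by (subst measure_measure_pmf_finite) (auto simp: W_def sum.reindex inj_on_def)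
    also have "\<dots> \<le> measure_pmf.prob WS (snd -` {s x})"
      by (intro measure_pmf.finite_measure_mono) auto
    also have "\<dots> = pmf PS (s x)"
      unfolding pmf_map[symmetric] by (simp add: WS_def PS_def map_pmf_comp split_beta')
    finally have "pmf P x / pmf PS (s x) * (\<Sum>w\<in>set_pmf W. pmf WS (w, s x))
        \<le> pmf P x / pmf PS (s x) * pmf PS (s x)"
      by (intro mult_left_mono) auto
    then show "pmf P x / pmf PS (s x) * (\<Sum>w\<in>set_pmf W. pmf WS (w, s x)) \<le> pmf P x"
      using psx by simp
  qed
  also have "\<dots> = 1" using fin by (intro sum_pmf_eq_1) (auto simp: P_def)
  finally have Er: "measure_pmf.expectation Q r \<le> 1" .

  \<comment> \<open>By \<open>ln r \<le> r - 1\<close> the density difference dominates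
    \<open>(1 - r) / ln b\<close>, whose mean is nonnegative because \<open>r\<close> has mean at
    most 1.\<close>
  have "0 \<le> measure_pmf.expectation Q (\<lambda>z. (1 - r z) / ln b)"
    using int Er b by simp
  also have "\<dots> \<le> ?I"
    unfolding I
  proof (rule integral_mono_AE[OF int int], rule AE_pmfI)
    fix z assume "z \<in> set_pmf Q"
    note p = pos[OF this]
    then have "r z > 0" by (simp add: r_def)
    have "1 - r z \<le> - ln (r z)" using ln_le_minus_one[OF \<open>r z > 0\<close>] by simp
    then have "(1 - r z) / ln b \<le> - log b (r z)"
      using b divide_right_mono[of "1 - r z" "- ln (r z)" "ln b"] by (simp add: log_def)
    also have "\<dots> = log b (pmf Q z / (pmf P (snd z) * pmf WS (fst z, s (snd z)))) -
        log b (pmf P (snd z) / (pmf P (snd z) * pmf PS (s (snd z))))"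
      using p b by (simp add: r_def log_mult_pos log_divide_pos)
    finally show "(1 - r z) / ln b \<le> log b (pmf Q z / (pmf P (snd z) * pmf WS (fst z, s (snd z)))) -
        log b (pmf P (snd z) / (pmf P (snd z) * pmf PS (s (snd z))))" .
  qed
  finally show "0 \<le> ?I" .
qed

subsection \<open>Blocks of independent copies\<close>

lemma replicate_pmf_Suc_pair:
  "replicate_pmf (Suc n) p = map_pmf (\<lambda>(x, xs). x # xs) (pair_pmf p (replicate_pmf n p))"
  by (simp add: pair_pmf_def map_bind_pmf)

lemma replicate_map_pmf:
  "replicate_pmf n (map_pmf f p) = map_pmf (map f) (replicate_pmf n p)"
  by (induction n) (simp_all add: map_bind_pmf bind_map_pmf)

lemma pmf_replicate_pmf:
  "length xs = n \<Longrightarrow> pmf (replicate_pmf n p) xs = prod_list (map (pmf p) xs)"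
proof (induction xs arbitrary: n)
  case (Cons x xs)
  then obtain m where n: "n = Suc m" "length xs = m" by auto
  have "inj (\<lambda>(x :: 'a, xs). x # xs)" by (auto simp: inj_def)
  from pmf_map_inj'[OF this, of "pair_pmf p (replicate_pmf m p)" "(x, xs)"]
  show ?case
    using Cons.IH[OF n(2)] n by (simp add: replicate_pmf_Suc_pair pmf_pair del: replicate_pmf.simps)
qed auto

lemma finite_set_replicate_pmf:
  "finite (set_pmf p) \<Longrightarrow> finite (set_pmf (replicate_pmf n p))"
  by (induction n) auto

lemma expectation_pair_pmf_mult:
  fixes g :: "'a \<Rightarrow> real" and h :: "'b \<Rightarrow> real"
  assumes "finite (set_pmf p)" "finite (set_pmf q)"
  shows "measure_pmf.expectation (pair_pmf p q) (\<lambda>(x, y). g x * h y)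
    = measure_pmf.expectation p g * measure_pmf.expectation q h"
proof -
  have "measure_pmf.expectation (pair_pmf p q) (\<lambda>(x, y). g x * h y)
      = (\<Sum>(x, y)\<in>set_pmf p \<times> set_pmf q. (g x * pmf p x) * (h y * pmf q y))"
    using assms by (subst integral_measure_pmf_real[of "set_pmf p \<times> set_pmf q"])
      (auto intro!: sum.cong simp: pmf_pair)
  also have "\<dots> = (\<Sum>x\<in>set_pmf p. g x * pmf p x) * (\<Sum>y\<in>set_pmf q. h y * pmf q y)"
    by (simp add: sum_product sum.cartesian_product)
  finally show ?thesis
    using assms by (simp add: integral_measure_pmf_real[of "set_pmf p"] integral_measure_pmf_real[of "set_pmf q"])
qed

text \<open>Independence makes the cross term a product of means and centering makes it vanish, so
  variances add.\<close>

lemma expectation_sum_list_replicate_pmf: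
  fixes g :: "'a \<Rightarrow> real"
  assumes fin: "finite (set_pmf p)" and zero: "measure_pmf.expectation p g = 0"
  shows "measure_pmf.expectation (replicate_pmf n p) (\<lambda>xs. (sum_list (map g xs))\<^sup>2)
    = n * measure_pmf.expectation p (\<lambda>x. (g x)\<^sup>2)"
proof (induction n)
  case (Suc n)
  define r where "r = replicate_pmf n p"
  define S where "S = (\<lambda>xs. sum_list (map g xs))"
  have finr: "finite (set_pmf r)" using fin by (simp add: r_def finite_set_replicate_pmf)
  have int: "integrable (measure_pmf (pair_pmf p r)) h" for h :: "_ \<Rightarrow> real"
    using fin finr by (intro integrable_measure_pmf_finite) simp
  have "measure_pmf.expectation (replicate_pmf (Suc n) p) (\<lambda>xs. (S xs)\<^sup>2)
     = measure_pmf.expectation (pair_pmf p r)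
         (\<lambda>z. (g (fst z))\<^sup>2 + 2 * (case z of (x, xs) \<Rightarrow> g x * S xs) + (S (snd z))\<^sup>2)"
    by (simp add: replicate_pmf_Suc_pair r_def[symmetric] S_def split_beta' power2_sum algebra_simps
        del: replicate_pmf.simps)
  also have "\<dots> = measure_pmf.expectation p (\<lambda>x. (g x)\<^sup>2) + n * measure_pmf.expectation p (\<lambda>x. (g x)\<^sup>2)"
    using int Suc.IH
    by (simp add: expectation_pair_pmf_mult[OF fin finr] zero
         expectation_pair_pmf_fst[of p r "\<lambda>x. (g x)\<^sup>2"]
         expectation_pair_pmf_snd[of p r "\<lambda>x. (S x)\<^sup>2"]) (simp add: r_def S_def)
  finally show ?case by (simp add: S_def algebra_simps)
qed simp

text \<open>Chebyshev's inequality for the sum of the centered \<open>g\<close>, whose mean square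
  is \<open>n * V\<close>.\<close>

lemma weak_law_replicate_pmf:
  fixes h :: "'a \<Rightarrow> real" and \<delta> \<mu> :: real
  assumes fin: "finite (set_pmf p)" and "\<delta> > 0"
  defines "\<mu> \<equiv> measure_pmf.expectation p h"
  shows "(\<lambda>n. measure_pmf.prob (replicate_pmf n p)
     {xs. \<not> \<bar>sum_list (map h xs) - n * \<mu>\<bar> \<le> n * \<delta>}) \<longlonglongrightarrow> 0"
proof -
  define g where "g = (\<lambda>x. h x - \<mu>)"
  define V where "V = measure_pmf.expectation p (\<lambda>x. (g x)\<^sup>2)"
  have zero: "measure_pmf.expectation p g = 0"
    using integrable_measure_pmf_finite[OF fin, of h] by (simp add: g_def \<mu>_def)
  have sum_g: "sum_list (map g xs) = sum_list (map h xs) - length xs * \<mu>" for xs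
    by (induction xs) (auto simp: g_def algebra_simps)
  have bound: "measure_pmf.prob (replicate_pmf n p)
     {xs. \<not> \<bar>sum_list (map h xs) - n * \<mu>\<bar> \<le> n * \<delta>} \<le> (V / \<delta>\<^sup>2) / n" if "n > 0" for n
  proof -
    let ?r = "replicate_pmf n p"
    have "measure_pmf.prob ?r {xs. \<not> \<bar>sum_list (map h xs) - n * \<mu>\<bar> \<le> n * \<delta>}
      \<le> measure_pmf.prob ?r {xs \<in> space (measure_pmf ?r). (n * \<delta>)\<^sup>2 \<le> (sum_list (map g xs))\<^sup>2}"
    proof (intro measure_pmf.finite_measure_mono_AE AE_pmfI impI)
      fix xs assume xs: "xs \<in> set_pmf ?r" "xs \<in> {xs. \<not> \<bar>sum_list (map h xs) - n * \<mu>\<bar> \<le> n * \<delta>}"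
      then have "n * \<delta> \<le> \<bar>sum_list (map g xs)\<bar>"
        by (auto simp: sum_g set_replicate_pmf)
      then have "(n * \<delta>)\<^sup>2 \<le> \<bar>sum_list (map g xs)\<bar>\<^sup>2"
        using \<open>\<delta> > 0\<close> by (intro power_mono) auto
      then show "xs \<in> {xs \<in> space (measure_pmf ?r). (n * \<delta>)\<^sup>2 \<le> (sum_list (map g xs))\<^sup>2}" by simp
    qed simp
    also have "\<dots> \<le> measure_pmf.expectation ?r (\<lambda>xs. (sum_list (map g xs))\<^sup>2) / (n * \<delta>)\<^sup>2"
      using that \<open>\<delta> > 0\<close> fin
      by (intro integral_Markov_inequality_measure[where A = "{}"])
        (auto intro!: integrable_measure_pmf_finite finite_set_replicate_pmf)
    also have "\<dots> = (V / \<delta>\<^sup>2) / n"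
      using that \<open>\<delta> > 0\<close>
      unfolding expectation_sum_list_replicate_pmf[OF fin zero] V_def[symmetric]
      by (simp add: power2_eq_square)
    finally show ?thesis .
  qed
  have lim: "(\<lambda>n. (V / \<delta>\<^sup>2) / real n) \<longlonglongrightarrow> 0"
    by (rule lim_const_over_n)
  show ?thesis
  proof (rule tendsto_sandwich[OF _ _ tendsto_const lim])
    show "\<forall>\<^sub>F n in sequentially. measure_pmf.prob (replicate_pmf n p)
        {xs. \<not> \<bar>sum_list (map h xs) - n * \<mu>\<bar> \<le> n * \<delta>} \<le> V / \<delta>\<^sup>2 / real n"
      using eventually_gt_at_top[of 0] by eventually_elim (rule bound)
  qed simp
qed

subsection \<open>Random coding\<close>

lemma prob_pair_pmf:
  "measure_pmf.prob (pair_pmf p q) S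
    = measure_pmf.expectation p (\<lambda>a. measure_pmf.prob q {b. (a, b) \<in> S})"
proof -
  have "emeasure (pair_pmf p q) S = (\<integral>\<^sup>+ z. indicator S z \<partial>pair_pmf p q)"
    by simp
  also have "\<dots> = (\<integral>\<^sup>+ a. ennreal (measure_pmf.prob q {b. (a, b) \<in> S}) \<partial>p)"
    unfolding nn_integral_pair_pmf'
  proof (rule nn_integral_cong)
    fix a
    have "(\<integral>\<^sup>+ b. indicator S (a, b) \<partial>measure_pmf q) = (\<integral>\<^sup>+ b. indicator {b. (a, b) \<in> S} b \<partial>measure_pmf q)"
      by (intro nn_integral_cong) (auto simp: indicator_def)
    then show "(\<integral>\<^sup>+ b. indicator S (a, b) \<partial>measure_pmf q) = ennreal (measure_pmf.prob q {b. (a, b) \<in> S})"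
      by (simp add: measure_pmf.emeasure_eq_measure)
  qed
  also have "\<dots> = ennreal (measure_pmf.expectation p (\<lambda>a. measure_pmf.prob q {b. (a, b) \<in> S}))"
    by (intro nn_integral_eq_integral measure_pmf.integrable_const_bound[where B = 1]) auto
  finally show ?thesis
    by (simp add: measure_pmf.emeasure_eq_measure)
qed

lemma prob_pair_pmf_le:
  assumes "\<And>a. a \<in> set_pmf p \<Longrightarrow> measure_pmf.prob q {b. (a, b) \<in> S} \<le> h a"
    and "integrable (measure_pmf p) h"
  shows "measure_pmf.prob (pair_pmf p q) S \<le> measure_pmf.expectation p h"
  unfolding prob_pair_pmf
  by (rule integral_mono_AE)
    (use assms in \<open>auto simp: AE_measure_pmf_iff intro!: measure_pmf.integrable_const_bound[where B = 1]\<close>)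

lemma prob_pair_pmf_le_const:
  assumes "\<And>a. a \<in> set_pmf p \<Longrightarrow> measure_pmf.prob q {b. (a, b) \<in> S} \<le> c"
  shows "measure_pmf.prob (pair_pmf p q) S \<le> c"
  using prob_pair_pmf_le[of p q S "\<lambda>_. c"] assms by simp

text \<open>An average is at least one of its values; this is the derandomization step of the
  probabilistic method.\<close>

lemma exists_le_prob_pair_pmf:
  "\<exists>a\<in>set_pmf p. measure_pmf.prob q {b. (a, b) \<in> S} \<le> measure_pmf.prob (pair_pmf p q) S"
proof (rule ccontr)
  let ?c = "measure_pmf.prob (pair_pmf p q) S"
  assume "\<not> ?thesis"
  then have lt: "?c < measure_pmf.prob q {b. (a, b) \<in> S}" if "a \<in> set_pmf p" for a
    using that by auto
  have "measure_pmf.expectation p (\<lambda>_. ?c) < measure_pmf.expectation p (\<lambda>a. measure_pmf.prob q {b. (a, b) \<in> S})"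
    by (intro measure_pmf.integral_less_AE_space measure_pmf.integrable_const_bound[where B = 1])
       (auto simp: AE_measure_pmf_iff lt)
  then show False by (simp add: prob_pair_pmf[symmetric])
qed

text \<open>With the factors swapped, the random code in the second component gets fixed while the
  source in the first stays random.\<close>

lemma exists_le_prob_pair_pmf_snd:
  "\<exists>b\<in>set_pmf q. measure_pmf.prob p {a. (a, b) \<in> S} \<le> measure_pmf.prob (pair_pmf p q) S"
proof -
  have "measure_pmf.prob (pair_pmf q p) (prod.swap ` S) = measure_pmf.prob (pair_pmf p q) S"
    by (subst pair_commute_pmf)
       (auto simp: measure_map_pmf intro!: arg_cong[where f = "measure_pmf.prob _"])
  then show ?thesis
    using exists_le_prob_pair_pmf[where p = q and q = p and S = "prod.swap ` S"]
    by (simp add: image_iff prod.swap_def split_beta' Bex_def)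
qed

lemma prob_Pi_pmf_component:
  fixes l L :: nat
  assumes "l < L"
  shows "measure_pmf.prob (Pi_pmf {..<L} d (\<lambda>_. p)) {c. c l \<in> A} = measure_pmf.prob p A"
proof -
  have "map_pmf (\<lambda>c. c l) (Pi_pmf {..<L} d (\<lambda>_. p)) = p"
    using assms by (simp add: Pi_pmf_component)
  then show ?thesis using measure_map_pmf[of "\<lambda>c. c l" "Pi_pmf {..<L} d (\<lambda>_. p)" A]
    by (simp add: vimage_def)
qed

lemma prob_Pi_pmf_all_notin:
  fixes L :: nat
  shows "measure_pmf.prob (Pi_pmf {..<L} d (\<lambda>_. p)) {c. \<forall>l<L. c l \<notin> A} = (1 - measure_pmf.prob p A) ^ L"
proof -
  have "{c. \<forall>l<L. c l \<notin> A} = Pi {..<L} (\<lambda>_. - A)" by auto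
  then show ?thesis
    by (simp add: measure_Pi_pmf_Pi measure_pmf.prob_compl[of A, simplified] Compl_eq_Diff_UNIV)
qed

text \<open>Splitting by the common value \<open>b\<close>, each of the \<open>B\<close> events
  prescribes two independent uniform coordinates and has probability
  \<open>(1 / B)\<^sup>2\<close>.\<close>

lemma prob_hash_collision:
  fixes B l l' L :: nat
  assumes "B > 0" "l < L" "l' < L" "l \<noteq> l'"
  shows "measure_pmf.prob (Pi_pmf {..<L} d (\<lambda>_. pmf_of_set {..<B})) {g. g l = g l'} \<le> 1 / B"
proof -
  let ?G = "Pi_pmf {..<L} d (\<lambda>_. pmf_of_set {..<B})"
  have ne: "{..<B} \<noteq> {}" using assms by auto
  have "measure_pmf.prob ?G {g. g l = g l'}
      = measure_pmf.prob ?G (\<Union>b<B. Pi {..<L} (\<lambda>j. if j = l \<or> j = l' then {b} else UNIV))"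
  \<comment> \<open>The events agree on the support, where \<open>g l < B\<close> supplies the index
    of the union.\<close>
  proof (intro measure_pmf.finite_measure_eq_AE AE_pmfI)
    fix g assume "g \<in> set_pmf ?G"
    then have "g l < B"
      using assms ne by (auto simp: set_Pi_pmf PiE_dflt_def)
    then show "g \<in> {g. g l = g l'} \<longleftrightarrow> g \<in> (\<Union>b<B. Pi {..<L} (\<lambda>j. if j = l \<or> j = l' then {b} else UNIV))"
      using assms by (auto simp: Pi_iff)
  qed auto
  also have "\<dots> \<le> (\<Sum>b<B. measure_pmf.prob ?G (Pi {..<L} (\<lambda>j. if j = l \<or> j = l' then {b} else UNIV)))"
    by (intro measure_pmf.finite_measure_subadditive_finite) auto
  also have "\<dots> = (\<Sum>b<B. (1 / B)\<^sup>2)"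
  proof (rule sum.cong[OF refl])
    fix b assume "b \<in> {..<B}"
    have "measure_pmf.prob ?G (Pi {..<L} (\<lambda>j. if j = l \<or> j = l' then {b} else UNIV))
       = (\<Prod>j<L. if j = l \<or> j = l' then 1 / B else 1)"
      using \<open>b \<in> {..<B}\<close> ne
    proof (subst measure_Pi_pmf_Pi)
      show "(\<Prod>j<L. measure_pmf.prob (pmf_of_set {..<B}) (if j = l \<or> j = l' then {b} else UNIV))
          = (\<Prod>j<L. if j = l \<or> j = l' then 1 / B else 1)"
      proof (rule prod.cong[OF refl])
        fix j
        show "measure_pmf.prob (pmf_of_set {..<B}) (if j = l \<or> j = l' then {b} else UNIV)
            = (if j = l \<or> j = l' then 1 / B else 1)"
          using \<open>b \<in> {..<B}\<close> ne by (cases "j = l \<or> j = l'") (simp_all add: measure_pmf_single)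
      qed
    qed simp
    also have "\<dots> = (\<Prod>j\<in>{l, l'}. 1 / B)"
      by (rule prod.mono_neutral_cong_right) (use assms in auto)
    also have "\<dots> = (1 / B)\<^sup>2" using assms by (simp add: power2_eq_square)
    finally show "measure_pmf.prob ?G (Pi {..<L} (\<lambda>j. if j = l \<or> j = l' then {b} else UNIV)) = (1 / B)\<^sup>2" .
  qed
  also have "\<dots> = 1 / B" using assms by (simp add: power2_eq_square)
  finally show ?thesis .
qed

text \<open>The estimate behind covering. After \<open>1 - p \<le> exp (- p)\<close>, the exponent
  is at most the point at fraction \<open>a\<close> between \<open>0\<close> and
  \<open>- real L / \<alpha>\<close>; convexity of \<open>exp\<close> then separates the uncoverable
  mass \<open>1 - a\<close> from the sampling error.\<close>

lemma power_one_minus_le: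
  fixes a p :: real
  assumes "0 \<le> a" "a \<le> 1" "a \<le> \<alpha> * p" "p \<le> 1" "\<alpha> > 0"
  shows "(1 - p) ^ L \<le> 1 - a + exp (- real L / \<alpha>)"
proof -
  have "a / \<alpha> \<le> p" using assms by (simp add: field_simps)
  have "(1 - p) ^ L \<le> exp (- p) ^ L"
    using assms exp_ge_add_one_self[of "- p"] by (intro power_mono) auto
  also have "\<dots> = exp (- (real L * p))" by (simp add: exp_of_nat_mult[symmetric])
  also have "\<dots> \<le> exp ((1 - a) *\<^sub>R 0 + a *\<^sub>R (- real L / \<alpha>))"
    using mult_left_mono[OF \<open>a / \<alpha> \<le> p\<close>, of "real L"] by (simp add: mult.commute)
  also have "\<dots> \<le> (1 - a) * exp 0 + a * exp (- real L / \<alpha>)"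
    using convex_onD[OF convex_on_exp[of 1, simplified], of a 0 "- real L / \<alpha>"] assms by simp
  also have "\<dots> \<le> 1 - a + exp (- real L / \<alpha>)"
    using assms by (simp add: mult_left_le_one_le)
  finally show ?thesis .
qed

section \<open>The one-shot broadcast code\<close>

text \<open>\<open>T\<close> plays the typical set, \<open>L\<close> counts codewords drawn from the
  law of W, and \<open>B\<close> counts bins. The error terms stand for an atypical pair, for no
  codeword matching the source, and for a wrong codeword of the same bin passing the test of some
  user.\<close>

lemma one_shot_broadcast_code:
  fixes Q :: "('w \<times> 'x) pmf" and s :: "'k::finite \<Rightarrow> 'x \<Rightarrow> 's"
    and \<alpha> :: real and \<beta> :: "'k \<Rightarrow> real" and L B :: nat
  assumes fin: "finite (set_pmf Q)" and \<alpha>: "\<alpha> > 0" and \<beta>: "\<And>i. \<beta> i > 0" and "B > 0"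
    and cover: "\<And>w x. (w, x) \<in> T \<Longrightarrow>
      pmf Q (w, x) \<le> \<alpha> * pmf (map_pmf fst Q) w * pmf (map_pmf snd Q) x"
    and pack: "\<And>w x i. (w, x) \<in> T \<Longrightarrow>
      \<beta> i * pmf (map_pmf fst Q) w * pmf (map_pmf (\<lambda>z. s i (snd z)) Q) (s i x)
        \<le> pmf (map_pmf (\<lambda>(w, x). (w, s i x)) Q) (w, s i x)"
  shows "\<exists>\<psi> dec. (\<forall>x. \<psi> x < B) \<and>
    measure_pmf.prob (map_pmf snd Q) {x. \<not> (\<exists>w. (w, x) \<in> T \<and> (\<forall>i. dec i (\<psi> x) (s i x) = w))}
      \<le> measure_pmf.prob Q (- T) + exp (- real L / \<alpha>) + (\<Sum>i\<in>UNIV. L / (B * \<beta> i))"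
proof -
  define P where "P = map_pmf snd Q"
  define W where "W = map_pmf fst Q"
  define Tx where "Tx = (\<lambda>x. {w. (w, x) \<in> T})"
  define PS where "PS = (\<lambda>i. map_pmf (\<lambda>z. s i (snd z)) Q)"
  define WS where "WS = (\<lambda>i. map_pmf (\<lambda>(w, x). (w, s i x)) Q)"
  \<comment> \<open>User \<open>i\<close>, seeing \<open>y\<close>, accepts the codewords passing
    this likelihood ratio test. By \<open>pack\<close> every \<open>w\<close> with
    \<open>(w, x) \<in> T\<close> passes it for \<open>y = s i x\<close>.\<close>
  define D where "D = (\<lambda>i y. {w. \<beta> i * pmf W w * pmf (PS i) y \<le> pmf (WS i) (w, y)})"
  have finP: "finite (set_pmf P)" and finW: "finite (set_pmf W)"
    using fin by (auto simp: P_def W_def)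

  \<comment> \<open>Change of measure: on \<open>D i y\<close> the law of W is at most
    \<open>1 / \<beta> i\<close> times the conditional law of W given \<open>y\<close>.\<close>
  have WD: "measure_pmf.prob W (D i y) \<le> 1 / \<beta> i" if "y \<in> set_pmf (PS i)" for i y
  proof -
    have pos: "pmf (PS i) y > 0" using that by (rule pmf_positive)
    let ?S = "D i y \<inter> set_pmf W"
    have "measure_pmf.prob W (D i y) = (\<Sum>w\<in>?S. pmf W w)"
      using finW by (subst measure_Int_set_pmf[symmetric]) (auto intro: measure_measure_pmf_finite)
    also have "\<dots> \<le> (\<Sum>w\<in>?S. pmf (WS i) (w, y) / (\<beta> i * pmf (PS i) y))"
      using pos \<beta>[of i] by (intro sum_mono) (simp add: D_def field_simps)
    also have "\<dots> = (\<Sum>w\<in>?S. pmf (WS i) (w, y)) / (\<beta> i * pmf (PS i) y)"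
      by (rule sum_divide_distrib[symmetric])
    also have "(\<Sum>w\<in>?S. pmf (WS i) (w, y)) = measure_pmf.prob (WS i) ((\<lambda>w. (w, y)) ` ?S)"
      using finW by (subst measure_measure_pmf_finite) (auto simp: sum.reindex inj_on_def)
    also have "\<dots> \<le> measure_pmf.prob (WS i) (snd -` {y})"
      by (intro measure_pmf.finite_measure_mono) auto
    also have "\<dots> = pmf (map_pmf snd (WS i)) y" by (simp add: pmf_map)
    also have "map_pmf snd (WS i) = PS i"
      by (simp add: WS_def PS_def map_pmf_comp split_beta')
    finally show ?thesis using pos \<beta>[of i] by (simp add: divide_right_mono field_simps)
  qed

  \<comment> \<open>The conditional probability of \<open>T\<close> given that the source is
    \<open>x\<close>.\<close>
  define a where "a = (\<lambda>x. measure_pmf.prob Q {z \<in> T. snd z = x} / pmf P x)"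
  have a_nonneg: "0 \<le> a x" for x by (simp add: a_def)
  have a_le_1: "a x \<le> 1" if "x \<in> set_pmf P" for x
  proof -
    have "measure_pmf.prob Q {z \<in> T. snd z = x} \<le> measure_pmf.prob Q (snd -` {x})"
      by (intro measure_pmf.finite_measure_mono) auto
    then show ?thesis using pmf_positive[OF that] by (simp add: a_def P_def pmf_map)
  qed
  \<comment> \<open>By \<open>cover\<close>, on \<open>Tx x\<close> the part of the law of W given
    \<open>x\<close> is at most \<open>\<alpha>\<close> times the unconditional law.\<close>
  have a_le: "a x \<le> \<alpha> * measure_pmf.prob W (Tx x)" if "x \<in> set_pmf P" for x
  proof -
    let ?S = "{z \<in> T. snd z = x} \<inter> set_pmf Q"
    have "measure_pmf.prob Q {z \<in> T. snd z = x} = (\<Sum>z\<in>?S. pmf Q z)"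
      using fin by (subst measure_Int_set_pmf[symmetric]) (auto intro: measure_measure_pmf_finite)
    also have "\<dots> \<le> (\<Sum>z\<in>?S. \<alpha> * pmf P x * pmf W (fst z))"
      using cover by (intro sum_mono) (auto simp: P_def W_def mult_ac)
    also have "\<dots> = \<alpha> * pmf P x * (\<Sum>w\<in>fst ` ?S. pmf W w)"
      by (subst sum.reindex) (auto simp: inj_on_def sum_distrib_left)
    also have "(\<Sum>w\<in>fst ` ?S. pmf W w) = measure_pmf.prob W (fst ` ?S)"
      using fin by (simp add: measure_measure_pmf_finite)
    also have "\<dots> \<le> measure_pmf.prob W (Tx x)"
      by (intro measure_pmf.finite_measure_mono) (auto simp: Tx_def)
    finally show ?thesis using pmf_positive[OF that] \<alpha>
      by (simp add: a_def field_simps)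
  qed
  have E_a: "measure_pmf.expectation P a = measure_pmf.prob Q T"
  proof -
    have "measure_pmf.expectation P a = (\<Sum>x\<in>set_pmf P. a x * pmf P x)"
      using finP by (simp add: integral_measure_pmf_real)
    also have "\<dots> = (\<Sum>x\<in>set_pmf P. measure_pmf.prob Q {z \<in> T. snd z = x})"
      by (intro sum.cong refl) (simp add: a_def set_pmf_iff)
    also have "\<dots> = measure_pmf.prob Q (\<Union>x\<in>set_pmf P. {z \<in> T. snd z = x})"
      using finP by (intro measure_pmf.finite_measure_finite_Union[symmetric])
        (auto simp: disjoint_family_on_def)
    also have "\<dots> = measure_pmf.prob Q T"
      by (intro measure_pmf.finite_measure_eq_AE) (auto simp: AE_measure_pmf_iff P_def)
    finally show ?thesis .
  qed

  define C where "C = Pi_pmf {..<L} (undefined :: 'w) (\<lambda>_. W)"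
  define G where "G = Pi_pmf {..<L} (0::nat) (\<lambda>_. pmf_of_set {..<B})"
  \<comment> \<open>The first codeword matching \<open>x\<close>. Without a match
    \<open>LEAST\<close> is unspecified, hence the guard \<open>idx c x < L\<close> in
    \<open>E2\<close>.\<close>
  define idx where "idx = (\<lambda>c x. LEAST l. l < L \<and> c l \<in> Tx x)"
  \<comment> \<open>\<open>E1\<close>: no codeword matches the source. \<open>E2 i\<close>: a
    competitor shares the bin of the chosen codeword and passes the test of user
    \<open>i\<close>.\<close>
  define E1 where "E1 = {(x, c :: nat \<Rightarrow> 'w, g :: nat \<Rightarrow> nat). \<forall>l<L. c l \<notin> Tx x}"
  define E2 where "E2 = (\<lambda>i. {(x, c, g :: nat \<Rightarrow> nat).
      \<exists>l<L. l \<noteq> idx c x \<and> idx c x < L \<and> g l = g (idx c x) \<and> c l \<in> D i (s i x)})"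

  \<comment> \<open>For fixed \<open>x\<close> the codewords miss \<open>Tx x\<close> independently;
    averaging \<open>1 - a x\<close> over the source leaves the mass outside
    \<open>T\<close>.\<close>
  have "measure_pmf.prob (pair_pmf P (pair_pmf C G)) E1
      \<le> measure_pmf.expectation P (\<lambda>x. 1 - a x + exp (- real L / \<alpha>))"
  proof (rule prob_pair_pmf_le)
    fix x assume x: "x \<in> set_pmf P"
    have "{b. (x, b) \<in> E1} = fst -` {c. \<forall>l<L. c l \<notin> Tx x}" by (auto simp: E1_def)
    then have "measure_pmf.prob (pair_pmf C G) {b. (x, b) \<in> E1}
      = measure_pmf.prob (map_pmf fst (pair_pmf C G)) {c. \<forall>l<L. c l \<notin> Tx x}"
      by simp
    also have "\<dots> = (1 - measure_pmf.prob W (Tx x)) ^ L"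
      by (simp add: map_fst_pair_pmf C_def prob_Pi_pmf_all_notin del: measure_map_pmf)
    also have "\<dots> \<le> 1 - a x + exp (- real L / \<alpha>)"
      by (rule power_one_minus_le[OF a_nonneg a_le_1[OF x] a_le[OF x] _ \<alpha>]) simp
    finally show "measure_pmf.prob (pair_pmf C G) {b. (x, b) \<in> E1} \<le> 1 - a x + exp (- real L / \<alpha>)" .
  qed (rule integrable_measure_pmf_finite[OF finP])
  also have "\<dots> = measure_pmf.prob Q (- T) + exp (- real L / \<alpha>)"
    using integrable_measure_pmf_finite[OF finP, of a] measure_pmf.prob_compl[of T Q]
    by (simp add: E_a Compl_eq_Diff_UNIV)
  finally have E1: "measure_pmf.prob (pair_pmf P (pair_pmf C G)) E1
      \<le> measure_pmf.prob Q (- T) + exp (- real L / \<alpha>)" .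

  have E2: "measure_pmf.prob (pair_pmf P (pair_pmf C G)) (E2 i) \<le> L / (B * \<beta> i)" for i
  proof (rule prob_pair_pmf_le_const)
    fix x assume x: "x \<in> set_pmf P"
    then have y: "s i x \<in> set_pmf (PS i)" by (auto simp: P_def PS_def)
    \<comment> \<open>The number of accepted codewords of \<open>c\<close>, each charged the
      collision probability \<open>1 / B\<close>.\<close>
    let ?h = "\<lambda>c. \<Sum>l<L. indicator {c. c l \<in> D i (s i x)} c / B"
    have int: "integrable (measure_pmf C) (indicator A :: _ \<Rightarrow> real)" for A
      by (rule measure_pmf.integrable_const_bound[where B = 1]) auto
    have "measure_pmf.prob (pair_pmf C G) {b. (x, b) \<in> E2 i} \<le> measure_pmf.expectation C ?h"
    \<comment> \<open>The chosen index depends on the codebook but not on the hash, so with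
      \<open>c\<close> frozen a union bound over collisions applies.\<close>
    proof (rule prob_pair_pmf_le)
      fix c
      let ?M = "{l\<in>{..<L}. l \<noteq> idx c x \<and> idx c x < L \<and> c l \<in> D i (s i x)}"
      have "measure_pmf.prob G {g. (c, g) \<in> {b. (x, b) \<in> E2 i}}
          \<le> measure_pmf.prob G (\<Union>l\<in>?M. {g. g l = g (idx c x)})"
        by (intro measure_pmf.finite_measure_mono) (auto simp: E2_def)
      also have "\<dots> \<le> (\<Sum>l\<in>?M. measure_pmf.prob G {g. g l = g (idx c x)})"
        by (intro measure_pmf.finite_measure_subadditive_finite) auto
      also have "\<dots> \<le> (\<Sum>l\<in>?M. indicator {c. c l \<in> D i (s i x)} c / B)"
        using \<open>B > 0\<close> by (intro sum_mono) (auto simp: G_def intro!: prob_hash_collision)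
      also have "\<dots> \<le> ?h c"
        by (intro sum_mono2) auto
      finally show "measure_pmf.prob G {g. (c, g) \<in> {b. (x, b) \<in> E2 i}} \<le> ?h c" .
    qed (auto intro!: int)
    also have "\<dots> = (\<Sum>l<L. measure_pmf.prob C {c. c l \<in> D i (s i x)} / B)"
      using int by (subst Bochner_Integration.integral_sum) auto
    also have "\<dots> = L * measure_pmf.prob W (D i (s i x)) / B"
      by (simp add: C_def prob_Pi_pmf_component)
    also have "\<dots> \<le> L * (1 / \<beta> i) / B"
      by (intro divide_right_mono mult_left_mono WD[OF y]) auto
    finally show "measure_pmf.prob (pair_pmf C G) {b. (x, b) \<in> E2 i} \<le> L / (B * \<beta> i)"
      by (simp add: mult.commute)
  qed

  have "measure_pmf.prob (pair_pmf P (pair_pmf C G)) (E1 \<union> (\<Union>i. E2 i))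
     \<le> measure_pmf.prob (pair_pmf P (pair_pmf C G)) E1
       + measure_pmf.prob (pair_pmf P (pair_pmf C G)) (\<Union>i. E2 i)"
    by (rule measure_Un_le) auto
  also have "measure_pmf.prob (pair_pmf P (pair_pmf C G)) (\<Union>i. E2 i)
     \<le> (\<Sum>i\<in>UNIV. measure_pmf.prob (pair_pmf P (pair_pmf C G)) (E2 i))"
    by (intro measure_pmf.finite_measure_subadditive_finite) auto
  also have "\<dots> \<le> (\<Sum>i\<in>UNIV. L / (B * \<beta> i))"
    by (intro sum_mono E2)
  finally have total: "measure_pmf.prob (pair_pmf P (pair_pmf C G)) (E1 \<union> (\<Union>i. E2 i))
     \<le> measure_pmf.prob Q (- T) + exp (- real L / \<alpha>) + (\<Sum>i\<in>UNIV. L / (B * \<beta> i))"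
    using E1 by linarith

  \<comment> \<open>One codebook and hash do at least as well as the average. Membership in the
    support keeps the hash values below \<open>B\<close>.\<close>
  obtain c g where cg: "(c, g) \<in> set_pmf (pair_pmf C G)"
    and le: "measure_pmf.prob P {x. (x, c, g) \<in> E1 \<union> (\<Union>i. E2 i)}
      \<le> measure_pmf.prob (pair_pmf P (pair_pmf C G)) (E1 \<union> (\<Union>i. E2 i))"
    using exists_le_prob_pair_pmf_snd[of "pair_pmf C G" P "E1 \<union> (\<Union>i. E2 i)"] by auto
  have g: "g l < B" if "l < L" for l
    using cg that \<open>B > 0\<close> set_pmf_of_set[of "{..<B}"]
    by (auto simp: G_def set_Pi_pmf PiE_dflt_def lessThan_empty_iff)
  \<comment> \<open>The default bin \<open>0\<close> is legal because \<open>B > 0\<close>, and it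
    is used only inside \<open>E1\<close>.\<close>
  define \<psi> where "\<psi> = (\<lambda>x. if \<exists>l<L. c l \<in> Tx x then g (idx c x) else 0)"
  \<comment> \<open>Any accepted codeword of the announced bin; outside the error events only the
    encoder's choice qualifies.\<close>
  define dec where "dec = (\<lambda>i m y. c (SOME l. l < L \<and> g l = m \<and> c l \<in> D i y))"
  have idx: "idx c x < L \<and> c (idx c x) \<in> Tx x" if "\<exists>l<L. c l \<in> Tx x" for x
    using LeastI_ex[OF that[unfolded Bex_def]] by (simp add: idx_def)
  have "\<forall>x. \<psi> x < B" using g idx \<open>B > 0\<close> by (auto simp: \<psi>_def)
  moreover have "(x, c, g) \<in> E1 \<union> (\<Union>i. E2 i)"
    if "\<not> (\<exists>w. (w, x) \<in> T \<and> (\<forall>i. dec i (\<psi> x) (s i x) = w))" for x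
  proof (rule ccontr)
    assume good: "(x, c, g) \<notin> E1 \<union> (\<Union>i. E2 i)"
    then have ex: "\<exists>l<L. c l \<in> Tx x" by (auto simp: E1_def)
    note l = idx[OF ex]
    have "dec i (\<psi> x) (s i x) = c (idx c x)" for i
    proof -
      have "c (idx c x) \<in> D i (s i x)"
        using pack[of "c (idx c x)" x i] l by (simp add: D_def Tx_def W_def PS_def WS_def)
      moreover have "\<psi> x = g (idx c x)" using ex by (simp add: \<psi>_def)
      ultimately have "(SOME l. l < L \<and> g l = \<psi> x \<and> c l \<in> D i (s i x)) = idx c x"
        using good l by (intro some_equality) (auto simp: E2_def)
      then show ?thesis by (simp add: dec_def)
    qed
    with l that show False by (auto simp: Tx_def)
  qed
  then have "measure_pmf.prob P {x. \<not> (\<exists>w. (w, x) \<in> T \<and> (\<forall>i. dec i (\<psi> x) (s i x) = w))}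
      \<le> measure_pmf.prob P {x. (x, c, g) \<in> E1 \<union> (\<Union>i. E2 i)}"
    by (intro measure_pmf.finite_measure_mono) auto
  ultimately show ?thesis
    using le total unfolding P_def by (intro exI[of _ \<psi>] exI[of _ dec] conjI) (assumption, linarith)
qed

section \<open>From one shot to long blocks\<close>

text \<open>Lifts a single-letter density identity to blocks: exponents add, so typicality becomes a
  bound on the sum of \<open>g\<close>.\<close>

lemma prod_list_powr_tilt:
  fixes b :: real
  assumes "b > 0" and "\<And>z. z \<in> set zs \<Longrightarrow> u z = b powr g z * v z * v' z"
  shows "prod_list (map u zs)
    = b powr sum_list (map g zs) * prod_list (map v zs) * prod_list (map v' zs)"
  using assms(2) by (induction zs) (use assms(1) in \<open>auto simp: powr_add\<close>)

text \<open>The one-shot code for \<open>n\<close> independent copies, with typicality supplied by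
  the weak law. Covering succeeds because \<open>L\<close> outgrows \<open>\<alpha>\<close>, packing
  because \<open>I - J i \<le> R\<close> lets \<open>B * \<beta> i\<close> outgrow
  \<open>L\<close>.\<close>

lemma asymptotic_broadcast_code:
  fixes Q :: "('w \<times> 'x) pmf" and s :: "'k::finite \<Rightarrow> 'x \<Rightarrow> 's" and b R \<epsilon> I :: real
  assumes fin: "finite (set_pmf Q)" and b: "b > 1" and "\<epsilon> > 0"
  defines "a \<equiv> \<lambda>z. log b (pmf Q z / (pmf (map_pmf fst Q) (fst z) * pmf (map_pmf snd Q) (snd z)))"
    and "c \<equiv> \<lambda>i z. log b (pmf (map_pmf (\<lambda>(w, x). (w, s i x)) Q) (fst z, s i (snd z))
        / (pmf (map_pmf fst Q) (fst z) * pmf (map_pmf (\<lambda>z. s i (snd z)) Q) (s i (snd z))))"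
  defines "I \<equiv> measure_pmf.expectation Q a"
    and "J \<equiv> \<lambda>i. measure_pmf.expectation Q (c i)"
  assumes I: "I \<ge> 0" and R: "R \<ge> 0" and IJR: "\<And>i. I - J i \<le> R"
  shows "\<forall>\<^sub>F n in sequentially. \<exists>(\<psi> :: 'x list \<Rightarrow> nat) dec B. 0 < B \<and> (\<forall>xs. \<psi> xs < B) \<and>
    log b (real B) \<le> real n * (R + \<epsilon>) \<and>
    measure_pmf.prob (replicate_pmf n (map_pmf snd Q))
      {xs. \<not> (\<exists>ws. list_all2 (\<lambda>w x. (w, x) \<in> set_pmf Q) ws xs \<and>
             (\<forall>i. dec i (\<psi> xs) (map (s i) xs) = ws))} < \<epsilon>"
proof -
  \<comment> \<open>The bin exponent \<open>R + 4 * \<delta>\<close> spends half of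
    \<open>\<epsilon>\<close>; for large \<open>n\<close> the other half absorbs the factor 2 from
    rounding up.\<close>
  define \<delta> where "\<delta> = \<epsilon> / 8"
  have \<delta>: "\<delta> > 0" using \<open>\<epsilon> > 0\<close> by (simp add: \<delta>_def)
  \<comment> \<open>Atypicality of \<open>a\<close>, atypicality of each \<open>c i\<close>, and
    geometric terms: one for covering and two per user for packing.\<close>
  define err where "err = (\<lambda>n.
      measure_pmf.prob (replicate_pmf n Q) {zs. \<not> \<bar>sum_list (map a zs) - n * I\<bar> \<le> n * \<delta>}
    + (\<Sum>i\<in>UNIV. measure_pmf.prob (replicate_pmf n Q) {zs. \<not> \<bar>sum_list (map (c i) zs) - n * J i\<bar> \<le> n * \<delta>})
    + (1 + 2 * CARD('k)) * (b powr - \<delta>) ^ n)"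
  have "err \<longlonglongrightarrow> 0 + (\<Sum>i\<in>(UNIV :: 'k set). 0) + (1 + 2 * real CARD('k)) * 0"
    unfolding err_def I_def J_def of_nat_add of_nat_mult of_nat_1 of_nat_numeral
    using b \<delta> fin
    by (intro tendsto_add tendsto_mult tendsto_const tendsto_sum weak_law_replicate_pmf LIMSEQ_realpow_zero)
       (auto simp: powr_less_one)
  then have "err \<longlonglongrightarrow> 0" by simp
  then have ev1: "\<forall>\<^sub>F n in sequentially. err n < \<epsilon>"
    using \<open>\<epsilon> > 0\<close> by (rule order_tendstoD)
  have "filterlim (\<lambda>n. real n * (\<epsilon> / 2)) at_top sequentially"
    using \<open>\<epsilon> > 0\<close>
    by (intro filterlim_at_top_mult_tendsto_pos[OF tendsto_const _ filterlim_real_sequentially]) auto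
  then have ev2: "\<forall>\<^sub>F n in sequentially. log b 2 \<le> real n * (\<epsilon> / 2)"
    by (simp add: filterlim_at_top)
  from ev1 ev2 show ?thesis
  proof eventually_elim
    case (elim n)
    define P W where "P = map_pmf snd Q" and "W = map_pmf fst Q"
    define WS PS where "WS = (\<lambda>i. map_pmf (\<lambda>(w, x). (w, s i x)) Q)"
      and "PS = (\<lambda>i. map_pmf (\<lambda>z. s i (snd z)) Q)"
    \<comment> \<open>Unzipping is injective, so it puts the block law into the form of a pair law
      without changing point masses.\<close>
    define U where "U = (\<lambda>zs :: ('w \<times> 'x) list. (map fst zs, map snd zs))"
    \<comment> \<open>One-sided typicality: the upper bound serves \<open>cover\<close>, the lower
      bounds serve \<open>pack\<close>. The support condition fixes the length and keeps the masses
      inside the logarithms positive.\<close>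
    define S where "S = {zs \<in> set_pmf (replicate_pmf n Q).
        sum_list (map a zs) \<le> n * (I + \<delta>) \<and> (\<forall>i. n * (J i - \<delta>) \<le> sum_list (map (c i) zs))}"
    define Qn where "Qn = map_pmf U (replicate_pmf n Q)"
    define \<alpha> where "\<alpha> = b powr (n * (I + \<delta>))"
    define \<beta> where "\<beta> = (\<lambda>i. b powr (n * (J i - \<delta>)))"
    define L where "L = nat \<lceil>b powr (n * (I + 2 * \<delta>))\<rceil>"
    define B where "B = nat \<lceil>b powr (n * (R + 4 * \<delta>))\<rceil>"
    define s' where "s' = (\<lambda>i. map (s i))"
    have injU: "inj U"
      unfolding U_def by (rule injI) (metis prod.inject zip_map_fst_snd)
    have fstQn: "map_pmf fst Qn = replicate_pmf n W"
      by (simp add: Qn_def U_def W_def map_pmf_comp replicate_map_pmf)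
    have sndQn: "map_pmf snd Qn = replicate_pmf n P"
      by (simp add: Qn_def U_def P_def map_pmf_comp replicate_map_pmf)
    have PSn: "map_pmf (\<lambda>z. s' i (snd z)) Qn = replicate_pmf n (PS i)" for i
      by (simp add: Qn_def U_def PS_def s'_def map_pmf_comp replicate_map_pmf o_def)
    have WSn: "map_pmf (\<lambda>(w, x). (w, s' i x)) Qn
        = map_pmf (\<lambda>vs. (map fst vs, map snd vs)) (replicate_pmf n (WS i))" for i
      by (simp add: Qn_def U_def WS_def s'_def map_pmf_comp replicate_map_pmf o_def split_beta')
    have S: "length zs = n" "set zs \<subseteq> set_pmf Q" if "zs \<in> S" for zs
      using that by (auto simp: S_def set_replicate_pmf)
    have pos: "pmf Q z > 0" "pmf W (fst z) > 0" "pmf P (snd z) > 0"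
        "pmf (WS i) (fst z, s i (snd z)) > 0" "pmf (PS i) (s i (snd z)) > 0" if "z \<in> set_pmf Q" for z i
      using that by (auto simp: W_def P_def WS_def PS_def pmf_positive_iff intro: rev_image_eqI)
    have cover: "pmf Qn (w, x) \<le> \<alpha> * pmf (map_pmf fst Qn) w * pmf (map_pmf snd Qn) x"
      if "(w, x) \<in> U ` S" for w x
    proof -
      from that obtain zs where zs: "zs \<in> S" "w = map fst zs" "x = map snd zs"
        by (auto simp: U_def)
      have "pmf Qn (U zs) = prod_list (map (pmf Q) zs)"
        using S(1)[OF zs(1)] by (simp add: Qn_def pmf_map_inj'[OF injU] pmf_replicate_pmf)
      also have "\<dots> = b powr sum_list (map a zs) * prod_list (map (\<lambda>z. pmf W (fst z)) zs)
          * prod_list (map (\<lambda>z. pmf P (snd z)) zs)"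
      proof (rule prod_list_powr_tilt)
        fix z assume "z \<in> set zs"
        with S[OF zs(1)] have "z \<in> set_pmf Q" by auto
        from pos[OF this] show "pmf Q z = b powr a z * pmf W (fst z) * pmf P (snd z)"
          using b by (simp add: a_def flip: W_def P_def)
      qed (use b in simp)
      also have "\<dots> \<le> \<alpha> * prod_list (map (\<lambda>z. pmf W (fst z)) zs) * prod_list (map (\<lambda>z. pmf P (snd z)) zs)"
        using zs(1) b by (intro mult_right_mono) (auto simp: \<alpha>_def S_def intro!: prod_list_nonneg)
      finally show ?thesis
        using S(1)[OF zs(1)] zs by (simp add: fstQn sndQn pmf_replicate_pmf o_def U_def)
    qed
    have pack: "\<beta> i * pmf (map_pmf fst Qn) w * pmf (map_pmf (\<lambda>z. s' i (snd z)) Qn) (s' i x)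
        \<le> pmf (map_pmf (\<lambda>(w, x). (w, s' i x)) Qn) (w, s' i x)"
      if "(w, x) \<in> U ` S" for w x i
    proof -
      from that obtain zs where zs: "zs \<in> S" "w = map fst zs" "x = map snd zs"
        by (auto simp: U_def)
      define vs where "vs = map (\<lambda>z. (fst z, s i (snd z))) zs"
      have inj: "inj (\<lambda>vs :: ('w \<times> 's) list. (map fst vs, map snd vs))"
        by (rule injI) (metis prod.inject zip_map_fst_snd)
      have "(w, s' i x) = (map fst vs, map snd vs)"
        using zs by (simp add: vs_def s'_def o_def)
      then have "pmf (map_pmf (\<lambda>(w, x). (w, s' i x)) Qn) (w, s' i x) = pmf (replicate_pmf n (WS i)) vs"
        using pmf_map_inj'[OF inj, of "replicate_pmf n (WS i)" vs] by (simp only: WSn)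
      also have "\<dots> = prod_list (map (\<lambda>z. pmf (WS i) (fst z, s i (snd z))) zs)"
        using S(1)[OF zs(1)] by (simp add: pmf_replicate_pmf vs_def o_def)
      also have "\<dots> = b powr sum_list (map (c i) zs) * prod_list (map (\<lambda>z. pmf W (fst z)) zs)
          * prod_list (map (\<lambda>z. pmf (PS i) (s i (snd z))) zs)"
      proof (rule prod_list_powr_tilt)
        fix z assume "z \<in> set zs"
        with S[OF zs(1)] have "z \<in> set_pmf Q" by auto
        from pos(1-3)[OF this] pos(4,5)[OF this, of i] show "pmf (WS i) (fst z, s i (snd z))
            = b powr c i z * pmf W (fst z) * pmf (PS i) (s i (snd z))"
          unfolding c_def W_def PS_def WS_def using b by simp
      qed (use b in simp)
      also have "\<dots> \<ge> \<beta> i * prod_list (map (\<lambda>z. pmf W (fst z)) zs)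
          * prod_list (map (\<lambda>z. pmf (PS i) (s i (snd z))) zs)"
        using zs(1) b by (intro mult_right_mono) (auto simp: \<beta>_def S_def intro!: prod_list_nonneg)
      finally show ?thesis
        unfolding fstQn PSn
        using S(1)[OF zs(1)] zs by (simp add: pmf_replicate_pmf o_def s'_def)
    qed

    \<comment> \<open>A nonnegative exponent makes the power at least 1, so rounding up at most
      doubles it; here the signs of \<open>I\<close> and \<open>R\<close> enter.\<close>
    have ceil: "real (nat \<lceil>b powr t\<rceil>) \<le> 2 * b powr t" "b powr t \<le> real (nat \<lceil>b powr t\<rceil>)"
      if "t \<ge> 0" for t
      using ge_one_powr_ge_zero[of b t] b that by linarith+
    have B_bounds: "b powr (n * (R + 4 * \<delta>)) \<le> real B" "real B \<le> 2 * b powr (n * (R + 4 * \<delta>))"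
      unfolding B_def by (rule ceil, use R \<delta> in simp)+
    have L_bounds: "b powr (n * (I + 2 * \<delta>)) \<le> real L" "real L \<le> 2 * b powr (n * (I + 2 * \<delta>))"
      unfolding L_def by (rule ceil, use I \<delta> in simp)+
    have bp: "b powr t > 0" for t using b by simp
    have "B > 0" using B_bounds(1) bp[of "n * (R + 4 * \<delta>)"] by linarith
    have pw: "b powr - (n * \<delta>) = (b powr - \<delta>) ^ n"
      using b by (simp add: powr_powr mult.commute flip: powr_realpow)

    obtain \<psi> dec where \<psi>: "\<forall>x. \<psi> x < B" and
      dec: "measure_pmf.prob (map_pmf snd Qn)
          {x. \<not> (\<exists>w. (w, x) \<in> U ` S \<and> (\<forall>i. dec i (\<psi> x) (s' i x) = w))}
        \<le> measure_pmf.prob Qn (- U ` S) + exp (- real L / \<alpha>) + (\<Sum>i\<in>UNIV. L / (B * \<beta> i))"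
      using one_shot_broadcast_code[of Qn \<alpha> \<beta> B "U ` S" s' L] cover pack b fin \<open>B > 0\<close>
      by (auto simp: \<alpha>_def \<beta>_def Qn_def finite_set_replicate_pmf)

    have "log b (real B) \<le> log b (2 * b powr (n * (R + 4 * \<delta>)))"
      using b B_bounds \<open>B > 0\<close> by (intro log_mono) auto
    also have "\<dots> = log b 2 + n * (R + 4 * \<delta>)"
      using b by (simp add: log_mult)
    also have "\<dots> \<le> n * (R + \<epsilon>)"
      using elim(2) by (simp add: \<delta>_def algebra_simps)
    finally have rate: "log b (real B) \<le> n * (R + \<epsilon>)" .

    have "measure_pmf.prob Qn (- U ` S) = measure_pmf.prob (replicate_pmf n Q) (- S)"
      by (simp add: Qn_def vimage_Compl inj_vimage_image_eq[OF injU])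
    \<comment> \<open>On the support, leaving \<open>S\<close> violates a one-sided bound and hence
      a two-sided deviation bound of the weak law.\<close>
    also have "\<dots> \<le> measure_pmf.prob (replicate_pmf n Q)
        ({zs. \<not> \<bar>sum_list (map a zs) - n * I\<bar> \<le> n * \<delta>} \<union>
         (\<Union>i. {zs. \<not> \<bar>sum_list (map (c i) zs) - n * J i\<bar> \<le> n * \<delta>}))"
    proof (intro measure_pmf.finite_measure_mono_AE AE_pmfI impI)
      fix zs assume "zs \<in> set_pmf (replicate_pmf n Q)" "zs \<in> - S"
      then consider "\<not> sum_list (map a zs) \<le> n * (I + \<delta>)"
        | i where "\<not> n * (J i - \<delta>) \<le> sum_list (map (c i) zs)"
        by (auto simp: S_def)
      then show "zs \<in> {zs. \<not> \<bar>sum_list (map a zs) - n * I\<bar> \<le> n * \<delta>} \<union>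
         (\<Union>i. {zs. \<not> \<bar>sum_list (map (c i) zs) - n * J i\<bar> \<le> n * \<delta>})"
      proof cases
        case 1
        then show ?thesis by (auto simp: algebra_simps)
      next
        case (2 i)
        then have "\<not> \<bar>sum_list (map (c i) zs) - n * J i\<bar> \<le> n * \<delta>" by (auto simp: algebra_simps)
        then show ?thesis by auto
      qed
    qed simp
    also have "\<dots> \<le> measure_pmf.prob (replicate_pmf n Q) {zs. \<not> \<bar>sum_list (map a zs) - n * I\<bar> \<le> n * \<delta>}
       + measure_pmf.prob (replicate_pmf n Q) (\<Union>i. {zs. \<not> \<bar>sum_list (map (c i) zs) - n * J i\<bar> \<le> n * \<delta>})"
      by (rule measure_Un_le) auto
    also have "measure_pmf.prob (replicate_pmf n Q) (\<Union>i. {zs. \<not> \<bar>sum_list (map (c i) zs) - n * J i\<bar> \<le> n * \<delta>})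
       \<le> (\<Sum>i\<in>UNIV. measure_pmf.prob (replicate_pmf n Q) {zs. \<not> \<bar>sum_list (map (c i) zs) - n * J i\<bar> \<le> n * \<delta>})"
      by (intro measure_pmf.finite_measure_subadditive_finite) auto
    finally have e1: "measure_pmf.prob Qn (- U ` S)
       \<le> measure_pmf.prob (replicate_pmf n Q) {zs. \<not> \<bar>sum_list (map a zs) - n * I\<bar> \<le> n * \<delta>}
         + (\<Sum>i\<in>UNIV. measure_pmf.prob (replicate_pmf n Q) {zs. \<not> \<bar>sum_list (map (c i) zs) - n * J i\<bar> \<le> n * \<delta>})"
      by simp

    \<comment> \<open>\<open>L / \<alpha>\<close> is at least \<open>b powr (n * \<delta>)\<close>,
      and the crude bound \<open>exp (- t) \<le> 1 / t\<close> already gives geometric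
      decay.\<close>
    have e2: "exp (- real L / \<alpha>) \<le> (b powr - \<delta>) ^ n"
    proof -
      have "b powr (n * (I + 2 * \<delta>)) = b powr (n * \<delta>) * \<alpha>"
        by (simp add: \<alpha>_def algebra_simps flip: powr_add)
      then have "b powr (n * \<delta>) \<le> real L / \<alpha>"
        using L_bounds(1) bp by (simp add: \<alpha>_def pos_le_divide_eq)
      then have "exp (- real L / \<alpha>) \<le> exp (- (b powr (n * \<delta>)))" by simp
      also have "\<dots> \<le> 1 / b powr (n * \<delta>)"
      proof -
        have "b powr (n * \<delta>) \<le> exp (b powr (n * \<delta>))"
          using exp_ge_add_one_self[of "b powr (n * \<delta>)"] by linarith
        then show ?thesis using bp[of "n * \<delta>"]
          by (simp add: exp_minus inverse_eq_divide frac_le)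
      qed
      also have "\<dots> = b powr - (n * \<delta>)" by (simp add: powr_minus_divide)
      finally show ?thesis by (simp add: pw)
    qed

    \<comment> \<open>The exponents add up to \<open>n * (I - J i - R - \<delta>)\<close>, at most
      \<open>- (n * \<delta>)\<close>; the factor 2 comes from rounding \<open>L\<close>.\<close>
    have e3: "L / (B * \<beta> i) \<le> 2 * (b powr - \<delta>) ^ n" for i
    proof -
      have "L / (B * \<beta> i) \<le> 2 * b powr (n * (I + 2 * \<delta>)) / (b powr (n * (R + 4 * \<delta>)) * \<beta> i)"
        using L_bounds B_bounds bp b by (intro frac_le mult_right_mono) (auto simp: \<beta>_def)
      also have "\<dots> = 2 * b powr (n * (I + 2 * \<delta>) - (n * (R + 4 * \<delta>) + n * (J i - \<delta>)))"
        by (simp add: \<beta>_def powr_diff powr_add)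
      also have "\<dots> \<le> 2 * b powr - (n * \<delta>)"
      proof -
        have "n * (I - J i) \<le> n * R" using IJR by (intro mult_left_mono) auto
        then show ?thesis using b by (simp add: algebra_simps)
      qed
      finally show ?thesis by (simp add: pw)
    qed
    have "(\<Sum>i\<in>UNIV. L / (B * \<beta> i)) \<le> (\<Sum>i\<in>(UNIV :: 'k set). 2 * (b powr - \<delta>) ^ n)"
      by (intro sum_mono e3)
    then have e4: "(\<Sum>i\<in>UNIV. L / (B * \<beta> i)) \<le> 2 * CARD('k) * (b powr - \<delta>) ^ n"
      by simp

    have "measure_pmf.prob (replicate_pmf n (map_pmf snd Q))
        {xs. \<not> (\<exists>ws. list_all2 (\<lambda>w x. (w, x) \<in> set_pmf Q) ws xs \<and>
             (\<forall>i. dec i (\<psi> xs) (map (s i) xs) = ws))}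
      \<le> measure_pmf.prob (map_pmf snd Qn)
          {x. \<not> (\<exists>w. (w, x) \<in> U ` S \<and> (\<forall>i. dec i (\<psi> x) (s' i x) = w))}"
    proof -
      \<comment> \<open>Typical blocks lie letterwise in the support of \<open>Q\<close>, which is
        what recovering function values requires.\<close>
      have "list_all2 (\<lambda>w x. (w, x) \<in> set_pmf Q) ws xs" if "(ws, xs) \<in> U ` S" for ws xs
        using that S(2) by (fastforce simp: U_def list_all2_map1 list_all2_map2 list_all2_same)
      then show ?thesis
        unfolding sndQn P_def[symmetric] s'_def
        by (intro measure_pmf.finite_measure_mono) auto
    qed
    also have "\<dots> \<le> err n"
      using dec e1 e2 e4 by (simp add: err_def algebra_simps)
    also have "\<dots> < \<epsilon>" by (rule elim(1))
    finally show ?case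
      using \<psi> rate \<open>B > 0\<close> by blast
  qed
qed

subsection \<open>The computation broadcast problem\<close>

lemma card_field_gt_1: "real CARD('a::{finite,field}) > 1"
proof -
  have "card {0, 1 :: 'a} \<le> CARD('a)" by (intro card_mono) auto
  then show ?thesis by simp
qed

text \<open>Singletons are independent. A maximal member of the finite family of independent sets
  through \<open>x\<close> is maximal among all of them, since supersets still contain
  \<open>x\<close>.\<close>

lemma ex_max_indep_set_containing:
  fixes E :: "'v::finite set set"
  shows "\<exists>w\<in>max_indep_sets E. x \<in> w"
proof -
  let ?F = "{w. indep w E \<and> x \<in> w}"
  have "indep {x} E" by (simp add: indep_def)
  then have "?F \<noteq> {}" by blast
  from finite_has_maximal[OF finite this]
  obtain w where w: "w \<in> ?F" "\<forall>w'\<in>?F. w \<subseteq> w' \<longrightarrow> w = w'" ..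
  then have "\<not> (\<exists>w'. indep w' E \<and> w \<subset> w')" by blast
  with w(1) show ?thesis unfolding max_indep_sets_def by blast
qed

text \<open>Choosing one maximal independent set through each point gives a deterministic coupling.
  This keeps the infimum in \<open>R_ach\<close> from ranging over the empty set.\<close>

lemma set_couplings_nonempty: "set_couplings P A f \<noteq> {}"
proof -
  obtain m where m: "m x \<in> max_indep_sets (broadcast_edges P A f)" "x \<in> m x" for x
    using ex_max_indep_set_containing by metis
  have "map_pmf (\<lambda>x. (m x, x)) P \<in> set_couplings P A f"
    unfolding set_couplings_def by (simp add: map_pmf_comp pmf_positive_iff image_iff m)
  then show ?thesis by auto
qed

text \<open>Otherwise the common side information would witness an edge of user \<open>i\<close>
  between two points of the independent set \<open>w\<close>.\<close>

lemma same_set_same_side_same_value: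
  assumes Q: "Q \<in> set_couplings P A f" and "(w, x) \<in> set_pmf Q" "(w, x') \<in> set_pmf Q"
    and eq: "side_info (A i) x = side_info (A i) x'"
  shows "f i x = f i x'"
proof (rule ccontr)
  assume ne: "f i x \<noteq> f i x'"
  have w: "w \<in> max_indep_sets (broadcast_edges P A f)" "x \<in> w" "x' \<in> w"
    using assms by (auto simp: set_couplings_def pmf_positive_iff)
  have P: "x \<in> set_pmf P" "x' \<in> set_pmf P"
    using imageI[OF assms(2), of snd] imageI[OF assms(3), of snd] Q
    by (simp_all add: set_couplings_def flip: set_map_pmf)
  define PXS where "PXS = map_pmf (\<lambda>x. (x, side_info (A i) x)) P"
  have "pmf PXS (x, side_info (A i) x) > 0" "pmf PXS (x', side_info (A i) x) > 0"
    using P eq by (auto simp: PXS_def pmf_positive_iff)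
  then have "\<exists>y. pmf PXS (x, y) * pmf PXS (x', y) > 0 \<and> f i x \<noteq> f i x'"
    using ne by (intro exI[of _ "side_info (A i) x"]) simp
  then have "{x, x'} \<in> broadcast_edges P A f"
    using ne by (auto simp: broadcast_edges_def user_edges_def Let_def PXS_def)
  moreover have "x \<noteq> x'" using ne by auto
  ultimately show False
    using w by (auto simp: max_indep_sets_def indep_def)
qed

lemma info_given_side_nonneg:
  fixes Q :: "(('a::{finite,field} ^ 'n::finite) set \<times> ('a ^ 'n)) pmf"
  shows "0 \<le> info_given_side Q A"
  unfolding info_given_side_def
  by (rule conditional_mutual_information_pmf(2)[OF _ card_field_gt_1]) simp


text \<open>The block code delivers the independent sets to every user, who then evaluates the
  demanded function letter by letter from set and side information.\<close>

lemma achievable_max_info_given_side: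
  fixes P :: "('a::{finite,field} ^ 'n::finite) pmf" and A :: "'k::finite \<Rightarrow> 'n set"
  assumes Q: "Q \<in> set_couplings P A f"
  shows "achievable_rate P A f (MAX i. info_given_side Q (A i))"
  unfolding achievable_rate_def
proof (intro allI impI)
  fix \<epsilon> :: real assume "\<epsilon> > 0"
  define R where "R = (MAX i. info_given_side Q (A i))"
  define s where "s = (\<lambda>i. side_info (A i) :: 'a ^ 'n \<Rightarrow> 'n \<Rightarrow> 'a)"
  have P: "map_pmf snd Q = P" using Q by (simp add: set_couplings_def)
  have fin: "finite (set_pmf Q)" by simp
  have IR: "info_given_side Q (A i) \<le> R" for i by (auto simp: R_def intro!: Max_ge)
  have R: "R \<ge> 0" using IR info_given_side_nonneg order.trans by blast
  note cmi = conditional_mutual_information_pmf(1)[OF fin card_field_gt_1]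
  have I: "0 \<le> measure_pmf.expectation Q (\<lambda>z. log (real CARD('a))
      (pmf Q z / (pmf (map_pmf fst Q) (fst z) * pmf (map_pmf snd Q) (snd z))))"
    using mutual_information_pmf[OF card_field_gt_1[where 'a = 'a], where Q = Q and X = fst and Y = snd]
    by simp
  \<comment> \<open>\<open>SOME\<close> picks any source vector compatible with \<open>w\<close> and
    \<open>y\<close>; on the support all of them share the value of \<open>f i\<close>.\<close>
  define F where "F = (\<lambda>i w y. f i (SOME x. (w, x) \<in> set_pmf Q \<and> s i x = y))"
  have F: "F i w (s i x) = f i x" if "(w, x) \<in> set_pmf Q" for i w x
  proof -
    have "(w, SOME x'. (w, x') \<in> set_pmf Q \<and> s i x' = s i x) \<in> set_pmf Q \<and>
        s i (SOME x'. (w, x') \<in> set_pmf Q \<and> s i x' = s i x) = s i x"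
      by (rule someI[of _ x]) (use that in simp)
    then show ?thesis
      using same_set_same_side_same_value[OF Q _ that] by (simp add: F_def s_def)
  qed
  have F_list: "map2 (F i) ws (map (s i) xs) = map (f i) xs"
    if "list_all2 (\<lambda>w x. (w, x) \<in> set_pmf Q) ws xs" for i ws xs
    using that by (induction rule: list_all2_induct) (auto simp: F)
  have "\<forall>\<^sub>F n in sequentially. \<exists>(\<psi> :: ('a ^ 'n) list \<Rightarrow> nat) dec B. 0 < B \<and> (\<forall>xs. \<psi> xs < B) \<and>
    log (real CARD('a)) (real B) \<le> real n * (R + \<epsilon>) \<and>
    measure_pmf.prob (replicate_pmf n (map_pmf snd Q))
      {xs. \<not> (\<exists>ws. list_all2 (\<lambda>w x. (w, x) \<in> set_pmf Q) ws xs \<and>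
             (\<forall>i. dec i (\<psi> xs) (map (s i) xs) = ws))} < \<epsilon>"
  proof (rule asymptotic_broadcast_code[OF fin card_field_gt_1 \<open>\<epsilon> > 0\<close> I R])
    fix i
    show "measure_pmf.expectation Q (\<lambda>z. log (real CARD('a))
          (pmf Q z / (pmf (map_pmf fst Q) (fst z) * pmf (map_pmf snd Q) (snd z))))
      - measure_pmf.expectation Q (\<lambda>z. log (real CARD('a))
          (pmf (map_pmf (\<lambda>(w, x). (w, s i x)) Q) (fst z, s i (snd z))
          / (pmf (map_pmf fst Q) (fst z) * pmf (map_pmf (\<lambda>z. s i (snd z)) Q) (s i (snd z))))) \<le> R"
      using IR[of i] by (simp add: info_given_side_def cmi s_def)
  qed
  then show "\<forall>\<^sub>F n in sequentially.
        \<exists>(\<psi> :: ('a ^ 'n) list \<Rightarrow> nat) (dec :: 'k \<Rightarrow> nat \<Rightarrow> ('n \<Rightarrow> 'a) list \<Rightarrow> 'a list).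
          prob_space.entropy (measure_pmf (replicate_pmf n P)) (real CARD('a)) (count_space UNIV) \<psi>
            \<le> real n * ((MAX i. info_given_side Q (A i)) + \<epsilon>) \<and>
          (\<forall>i. measure_pmf.prob (replicate_pmf n P)
                 {xs. dec i (\<psi> xs) (map (side_info (A i)) xs) \<noteq> map (f i) xs} < \<epsilon>)"
  proof eventually_elim
    case (elim n)
    then obtain \<psi> dec B where B: "\<forall>xs. \<psi> xs < B" "log (real CARD('a)) (real B) \<le> real n * (R + \<epsilon>)"
      and err: "measure_pmf.prob (replicate_pmf n P)
        {xs. \<not> (\<exists>ws. list_all2 (\<lambda>w x. (w, x) \<in> set_pmf Q) ws xs \<and>
             (\<forall>i. dec i (\<psi> xs) (map (s i) xs) = ws))} < \<epsilon>"
      unfolding P by blast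
    define dec' where "dec' = (\<lambda>i m ys. map2 (F i) (dec i m ys) ys)"
    have "prob_space.entropy (measure_pmf (replicate_pmf n P)) (real CARD('a)) (count_space UNIV) \<psi>
        \<le> real n * (R + \<epsilon>)"
      using entropy_pmf_le_log_bound[OF card_field_gt_1, of \<psi> B] B order.trans by blast
    moreover have "measure_pmf.prob (replicate_pmf n P)
        {xs. dec' i (\<psi> xs) (map (side_info (A i)) xs) \<noteq> map (f i) xs} < \<epsilon>" for i
    proof (rule le_less_trans[OF measure_pmf.finite_measure_mono err])
      show "{xs. dec' i (\<psi> xs) (map (side_info (A i)) xs) \<noteq> map (f i) xs}
        \<subseteq> {xs. \<not> (\<exists>ws. list_all2 (\<lambda>w x. (w, x) \<in> set_pmf Q) ws xs \<and>
             (\<forall>i. dec i (\<psi> xs) (map (s i) xs) = ws))}"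
      proof safe
        fix xs ws
        assume "dec' i (\<psi> xs) (map (side_info (A i)) xs) \<noteq> map (f i) xs"
          and ws: "list_all2 (\<lambda>w x. (w, x) \<in> set_pmf Q) ws xs"
            "\<forall>i. dec i (\<psi> xs) (map (s i) xs) = ws"
        moreover have "dec' i (\<psi> xs) (map (s i) xs) = map (f i) xs"
          using F_list[OF ws(1)] ws(2) by (simp add: dec'_def)
        ultimately show False by (simp add: s_def)
      qed
    qed simp
    ultimately show ?case unfolding R_def by blast
  qed
qed

section \<open>The lower bound\<close>

lemma achievable_rate_nonneg:
  fixes P :: "('a::{finite,field} ^ 'n::finite) pmf"
  assumes "achievable_rate P A f R"
  shows "0 \<le> R"
proof (rule field_le_epsilon)
  fix \<epsilon> :: real assume "\<epsilon> > 0"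
  with assms have "\<forall>\<^sub>F n in sequentially. \<exists>\<psi> :: ('a ^ 'n) list \<Rightarrow> nat.
      prob_space.entropy (measure_pmf (replicate_pmf n P)) (real CARD('a)) (count_space UNIV) \<psi>
        \<le> real n * (R + \<epsilon>)"
    unfolding achievable_rate_def by (fast elim: eventually_mono)
  with eventually_gt_at_top[of 0] have "\<forall>\<^sub>F n::nat in sequentially. 0 \<le> R + \<epsilon>"
  proof eventually_elim
    case (elim n)
    then obtain \<psi> :: "('a ^ 'n) list \<Rightarrow> nat" where
      "prob_space.entropy (measure_pmf (replicate_pmf n P)) (real CARD('a)) (count_space UNIV) \<psi>
        \<le> real n * (R + \<epsilon>)" by blast
    then have "0 \<le> real n * (R + \<epsilon>)"
      using entropy_pmf_nonneg[OF card_field_gt_1] order.trans by blast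
    then show ?case using elim(1) by (simp add: zero_le_mult_iff)
  qed
  then show "0 \<le> R + \<epsilon>" by simp
qed

text \<open>In I(X; (U, S)) - I(X; S) the first term is nonnegative and the second depends on
  \<open>P\<close> alone. The bound is thus uniform over all auxiliary variables, also those with
  infinite support.\<close>

lemma info_given_side_ge:
  fixes P :: "('a::{finite,field} ^ 'n::finite) pmf"
  assumes "map_pmf snd Q = P"
  shows "- prob_space.mutual_information (measure_pmf P) (real CARD('a))
      (count_space UNIV) (count_space UNIV) (\<lambda>x. x) (side_info A)
    \<le> info_given_side (Q :: (nat \<times> ('a ^ 'n)) pmf) A"
proof -
  have pm: "count_space UNIV \<Otimes>\<^sub>M count_space UNIV = (count_space UNIV :: (nat \<times> ('n \<Rightarrow> 'a)) measure)"
    by (simp add: pair_measure_countable)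
  show ?thesis
    using mutual_information_pmf(2)[OF card_field_gt_1, where Q = Q and X = snd
        and Y = "\<lambda>z. (fst z, side_info A (snd z))"]
    unfolding info_given_side_def prob_space.conditional_mutual_information_def[OF measure_pmf.prob_space_axioms] pm
    by (simp add: mutual_information_pmf(1)[OF card_field_gt_1] map_pmf_comp flip: assms)
qed

text \<open>A constant first component leaves the joint masses unchanged, so the two mutual
  informations in the definition cancel.\<close>

lemma info_given_side_const:
  fixes P :: "('a::{finite,field} ^ 'n::finite) pmf"
  shows "info_given_side (map_pmf (Pair (u :: nat)) P) A = 0"
proof -
  let ?Q = "map_pmf (Pair u) P"
  have pm: "count_space UNIV \<Otimes>\<^sub>M count_space UNIV = (count_space UNIV :: (nat \<times> ('n \<Rightarrow> 'a)) measure)"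
    by (simp add: pair_measure_countable)
  have "pmf (map_pmf (\<lambda>x. (x, u, side_info A x)) P) (x, u, side_info A x)
      = pmf (map_pmf (\<lambda>x. (x, side_info A x)) P) (x, side_info A x)" for x
    using pmf_map_inj'[of "\<lambda>x. (x, u, side_info A x)" P x] pmf_map_inj'[of "\<lambda>x. (x, side_info A x)" P x]
    by (simp add: inj_def)
  moreover have "pmf (map_pmf (\<lambda>x. (u, side_info A x)) P) (u, y) = pmf (map_pmf (side_info A) P) y" for y
    using pmf_map_inj'[of "Pair u" "map_pmf (side_info A) P" y] by (simp add: inj_def map_pmf_comp)
  ultimately show ?thesis
    unfolding info_given_side_def prob_space.conditional_mutual_information_def[OF measure_pmf.prob_space_axioms] pm
    by (simp add: mutual_information_pmf(1)[OF card_field_gt_1] map_pmf_comp)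
qed

lemma R_con_nonpos:
  fixes P :: "('a::{finite,field} ^ 'n::finite) pmf" and A :: "'k::finite \<Rightarrow> 'n set"
  shows "R_con P A \<le> 0"
proof -
  have snd: "map_pmf snd (aux_joint P \<kappa>) = P" for \<kappa>
    by (simp add: aux_joint_def map_bind_pmf bind_return_pmf')
  have const: "aux_joint P (\<lambda>_. return_pmf 0) = map_pmf (Pair 0) P"
    by (simp add: aux_joint_def bind_return_pmf map_pmf_def)
  \<comment> \<open>A real infimum lies below the members of its family once the family is bounded
    below. \<open>A undefined\<close> belongs to an arbitrary user.\<close>
  have "bdd_below (range (\<lambda>\<kappa>. MAX i. info_given_side (aux_joint P \<kappa>) (A i)))"
  proof (rule bdd_belowI2)
    fix \<kappa>
    have "- prob_space.mutual_information (measure_pmf P) (real CARD('a))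
        (count_space UNIV) (count_space UNIV) (\<lambda>x. x) (side_info (A undefined))
      \<le> info_given_side (aux_joint P \<kappa>) (A undefined)"
      by (rule info_given_side_ge[OF snd])
    also have "\<dots> \<le> (MAX i. info_given_side (aux_joint P \<kappa>) (A i))"
      by (intro Max_ge) auto
    finally show "- prob_space.mutual_information (measure_pmf P) (real CARD('a))
        (count_space UNIV) (count_space UNIV) (\<lambda>x. x) (side_info (A undefined))
      \<le> (MAX i. info_given_side (aux_joint P \<kappa>) (A i))" .
  qed
  then have "R_con P A \<le> (MAX i. info_given_side (aux_joint P (\<lambda>_. return_pmf 0)) (A i))"
    unfolding R_con_def by (rule cINF_lower) simp
  also have "\<dots> = 0" by (simp add: const info_given_side_const)
  finally show ?thesis .
qed

theorem theorem1:
  fixes P :: "('a::{finite,field} ^ 'n::finite) pmf"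
    and A :: "'k::finite \<Rightarrow> 'n set"
    and f :: "'k \<Rightarrow> 'a ^ 'n \<Rightarrow> 'a"
  shows "R_con P A \<le> R_opt P A f \<and> R_opt P A f \<le> R_ach P A f"
proof
  \<comment> \<open>A lower bound of a real set passes to \<open>Inf\<close> only if the set is
    nonempty; any coupling supplies an achievable rate.\<close>
  have "{R. achievable_rate P A f R} \<noteq> {}"
    using set_couplings_nonempty[of P A f] achievable_max_info_given_side by blast
  then have "0 \<le> R_opt P A f"
    unfolding R_opt_def by (rule cInf_greatest) (auto intro: achievable_rate_nonneg)
  with R_con_nonpos[of P A] show "R_con P A \<le> R_opt P A f" by (rule order.trans)
next
  have "bdd_below {R. achievable_rate P A f R}"
    by (rule bdd_belowI[of _ 0]) (auto intro: achievable_rate_nonneg)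
  then show "R_opt P A f \<le> R_ach P A f"
    unfolding R_ach_def R_opt_def
    by (intro cINF_greatest set_couplings_nonempty cInf_lower)
       (auto intro: achievable_max_info_given_side)
qed

end
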